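(* Let $d\ge 1$, let $L\subset\mathbb{R}^d$ be a lattice with fundamental domain $\Omega$ and dual lattice $L^{\perp}$. Let $0\le\gamma<1$. Suppose that for some $C>0$ the function $\sigma:L^{\perp}\to\mathbb{C}$ satisfies $$|\sigma(\kappa)|\le C\langle\kappa\rangle^{-\gamma}\quad\text{for all }\kappa\in L^{\perp},\qquad \langle\kappa\rangle:=(1+|\kappa|^2)^{1/2}.$$ Let $T$ be the Fourier multiplier with symbol $\sigma$, i.e. $\widehat{Tf}(\kappa)=\sigma(\kappa)\widehat f(\kappa)$ for all $\kappa\in L^{\perp}$. Then $$T:\mathrm{Lip}_{\Omega}(\alpha;2)\to\mathrm{Lip}_{\Omega}(\alpha+\gamma;2)$$ is bounded (with respect to the norms $\|\cdot\|_{\mathrm{Lip}_\Omega(\alpha;2)}$ and $\|\cdot\|_{\mathrm{Lip}_\Omega(\alpha+\gamma;2)}$ defined in the context) for every $\alpha\in\mathbb{R}$ with $0<\alpha<1-\gamma$.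
   Context: A lattice is $L=A\mathbb{Z}^d$ with $A$ an invertible real $d\times d$ matrix; its dual lattice is $L^{\perp}:=(A^{T})^{-1}\mathbb{Z}^d$. A fundamental domain of $L$ is a measurable set $\Omega\subseteq\mathbb{R}^d$ such that $\Omega+L=\mathbb{R}^d$ as a direct sum (every $x\in\mathbb{R}^d$ is uniquely $\omega+\ell$ with $\omega\in\Omega$, $\ell\in L$). $L^p(\Omega)$ is taken with respect to the normalised measure $\mathrm{d}x/|\Omega|$; functions on $\Omega$ are extended $L$-periodically to $\mathbb{R}^d$, which gives meaning to $f(\cdot+h)$. The Fourier transform is $\widehat f(\kappa)=\frac{1}{|\Omega|}\int_{\Omega}f(x)e^{-2\pi i\kappa\cdot x}\,\mathrm{d}x$ for $\kappa\in L^{\perp}$. For $0<\alpha\le1$, $1<p\le\infty$, the additive Hölder-Lipschitz space is $$\mathrm{Lip}_{\Omega}(\alpha;p):=\{f\in L^p(\Omega): \|f(\cdot+h)-f(\cdot)\|_{L^p(\Omega)}=O(|h|^{\alpha})\text{ as }h\to0\},$$ where $O$ means: bounded by $C'|h|^\alpha$ for some constant $C'>0$ and all $h$ in a neighbourhood of $0$. For $0<\alpha<1$ the space $\mathrm{Lip}_{\Omega}(\alpha;2)$ is endowed with the norm $$\|f\|_{\mathrm{Lip}_{\Omega}(\alpha;2)}:=\|f\|_{L^2(\Omega)}+\sup_{N\in\mathbb{N}}N^{\alpha}\Big(\sum_{\kappa\in L^\perp,\ |\kappa|>N}|\widehat f(\kappa)|^2\Big)^{1/2}.$$ $|\cdot|$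 is the Euclidean norm and $0\in\mathbb{N}$. *)

theory Defs
  imports "HOL-Analysis.Analysis"
begin

definition lattice :: "real^'n^'n \<Rightarrow> (real^'n) set"
  where "lattice A = (\<lambda>z. A *v z) ` {z. \<forall>i. z $ i \<in> \<int>}"

definition dual_lattice :: "real^'n^'n \<Rightarrow> (real^'n) set"
  where "dual_lattice A = lattice (matrix_inv (transpose A))"

definition fundamental_domain :: "(real^'n) set \<Rightarrow> (real^'n) set \<Rightarrow> bool"
  where "fundamental_domain L \<Omega> \<longleftrightarrow>
    \<Omega> \<in> sets lebesgue \<and> (\<forall>x. \<exists>!p. p \<in> \<Omega> \<times> L \<and> x = fst p + snd p)"

definition periodic_extension ::
  "(real^'n) set \<Rightarrow> (real^'n) set \<Rightarrow> (real^'n \<Rightarrow> complex) \<Rightarrow> real^'n \<Rightarrow> complex"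
  where "periodic_extension L \<Omega> f x = f (THE \<omega>. \<omega> \<in> \<Omega> \<and> x - \<omega> \<in> L)"

(* Functions on \<Omega> are represented by total functions; only their values on \<Omega> matter,
   and functions agreeing almost everywhere on \<Omega> are not identified. *)
definition L2_space :: "(real^'n) set \<Rightarrow> (real^'n \<Rightarrow> complex) set"
  where "L2_space \<Omega> = {f. f \<in> borel_measurable (lebesgue_on \<Omega>) \<and>
    integrable (lebesgue_on \<Omega>) (\<lambda>x. (cmod (f x))\<^sup>2)}"

definition L2_norm :: "(real^'n) set \<Rightarrow> (real^'n \<Rightarrow> complex) \<Rightarrow> real"
  where "L2_norm \<Omega> f =
    sqrt ((\<integral>x. (cmod (f x))\<^sup>2 \<partial>lebesgue_on \<Omega>) / measure lebesgue \<Omega>)"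

definition fourier_coeff :: "(real^'n) set \<Rightarrow> (real^'n \<Rightarrow> complex) \<Rightarrow> real^'n \<Rightarrow> complex"
  where "fourier_coeff \<Omega> f \<kappa> =
    (\<integral>x. f x * cis (- 2 * pi * (\<kappa> \<bullet> x)) \<partial>lebesgue_on \<Omega>) / of_real (measure lebesgue \<Omega>)"

(* The Hoelder-Lipschitz space of exponent p = 2. *)
definition Lip2 :: "real^'n^'n \<Rightarrow> (real^'n) set \<Rightarrow> real \<Rightarrow> (real^'n \<Rightarrow> complex) set"
  where "Lip2 A \<Omega> \<alpha> = {f \<in> L2_space \<Omega>. \<exists>C>0. \<forall>\<^sub>F h in nhds 0.
    L2_norm \<Omega> (\<lambda>x. periodic_extension (lattice A) \<Omega> f (x + h)
                    - periodic_extension (lattice A) \<Omega> f x) \<le> C * norm h powr \<alpha>}"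

(* Valued in ennreal so that the supremum needs no side condition. The inner sum converges
   for every square-integrable f by Bessel's inequality. *)
definition Lip2_norm ::
  "real^'n^'n \<Rightarrow> (real^'n) set \<Rightarrow> real \<Rightarrow> (real^'n \<Rightarrow> complex) \<Rightarrow> ennreal"
  where "Lip2_norm A \<Omega> \<alpha> f = ennreal (L2_norm \<Omega> f) +
    (SUP N::nat. ennreal (real N powr \<alpha> *
       sqrt (\<Sum>\<^sub>\<infinity>\<kappa>\<in>{\<kappa> \<in> dual_lattice A. norm \<kappa> > real N}. (cmod (fourier_coeff \<Omega> f \<kappa>))\<^sup>2)))"

definition japanese_bracket :: "real^'n \<Rightarrow> real"
  where "japanese_bracket \<kappa> = sqrt (1 + (norm \<kappa>)\<^sup>2)"

(* Determines T f only up to equality almost everywhere on \<Omega>. *)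
definition is_fourier_multiplier ::
  "real^'n^'n \<Rightarrow> (real^'n) set \<Rightarrow> (real^'n \<Rightarrow> complex) \<Rightarrow>
   ((real^'n \<Rightarrow> complex) \<Rightarrow> (real^'n \<Rightarrow> complex)) \<Rightarrow> bool"
  where "is_fourier_multiplier A \<Omega> \<sigma> T \<longleftrightarrow>
    (\<forall>f \<in> L2_space \<Omega>. T f \<in> L2_space \<Omega> \<and>
      (\<forall>\<kappa> \<in> dual_lattice A. fourier_coeff \<Omega> (T f) \<kappa> = \<sigma> \<kappa> * fourier_coeff \<Omega> f \<kappa>))"

end

(*
  For 0 < \<alpha> < 1 the class Lip(\<alpha>; 2) consists of those f in L^2 with
  sum over |\<kappa>| > R of |f^(\<kappa>)|^2 = O(R^(-2 \<alpha>)) (Titchmarsh): f(. + h) - f has the coefficients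
  (e^(2 \<pi> i \<kappa> h) - 1) f^(\<kappa>), and both directions follow by cutting the frequencies into dyadic shells.  Multiplication by \<sigma> improves the tail by the factor R^(-2 \<gamma>).

  This needs Parseval's identity on an arbitrary measurable fundamental domain.  Translations act on \<Omega>
  modulo L by measure preserving maps, which gives the orthogonality of the characters.
  For completeness, a function u with vanishing coefficients is orthogonal to all continuous functions
  of the torus map, by Stone-Weierstrass; for compact X inside \<Omega> the indicator of X is, on \<Omega>, a limit
  of such functions, and inner regularity yields u = 0 almost everywhere.
*)
theory Submission
  imports Defs
begin

section \<open>Lattices and fundamental domains\<close>

text \<open>All estimates concern finite sets of frequencies, so that Bessel's inequality feeds them
  directly; infinite sums occur only in the final norm. Parseval is used only as an upper bound for
  the L2 norm. It comes from Riesz-Fischer, which builds a function of controlled norm with the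
  coefficients of f; completeness identifies it with f. Riesz-Fischer also provides the existence of
  T. The obstacle is that \<Omega> may be unbounded and irregular: its volume must be shown finite,
  and the inverse of the torus map on \<Omega> need not be continuous. A compact X helps because its
  image is closed, so the distance to that image separates X from every other point of \<Omega>. The
  condition \<alpha> + \<gamma> < 1 enters when tails are turned back into differences. With \<beta>
  = \<alpha> + \<gamma>, the low frequencies contribute R^(2 - 2 \<beta>), a sum over dyadic shells
  that its top shell dominates when \<beta> < 1. The norm bound is direct, since the norm is itself
  defined by tails, and its constant is C.\<close>

lemma matrix_inv_self:
  fixes A :: "real^'n^'n"
  assumes "invertible A"
  shows "A ** matrix_inv A = mat 1" "matrix_inv A ** A = mat 1"
  using someI_ex[OF assms[unfolded invertible_def]] by (auto simp: matrix_inv_def)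

lemma zero_in_lattice [simp]: "0 \<in> lattice A"
  unfolding lattice_def by (rule image_eqI[where x = 0]) auto

lemma lattice_add: "x \<in> lattice A \<Longrightarrow> y \<in> lattice A \<Longrightarrow> x + y \<in> lattice A"
  unfolding lattice_def by (auto simp flip: matrix_vector_right_distrib)

lemma lattice_diff: "x \<in> lattice A \<Longrightarrow> y \<in> lattice A \<Longrightarrow> x - y \<in> lattice A"
  unfolding lattice_def by (auto simp flip: matrix_vector_mult_diff_distrib)

lemma lattice_minus: "x \<in> lattice A \<Longrightarrow> - x \<in> lattice A"
  using lattice_diff[of 0 A x] by simp

text \<open>Countability turns coverings and tilings by lattice translates into countable unions and
  sums of measures.\<close>

lemma countable_lattice: "countable (lattice A)"
proof -
  have "{z :: real^'n. \<forall>i. z $ i \<in> \<int>} \<subseteq> range (\<lambda>v :: int^'n. \<chi> i. of_int (v $ i))"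
  proof
    fix z :: "real^'n" assume "z \<in> {z. \<forall>i. z $ i \<in> \<int>}"
    then have "z = (\<chi> i. of_int ((\<chi> i. \<lfloor>z $ i\<rfloor>) $ i))" by (simp add: vec_eq_iff)
    then show "z \<in> range (\<lambda>v :: int^'n. \<chi> i. of_int (v $ i))" by blast
  qed
  then have "countable {z :: real^'n. \<forall>i. z $ i \<in> \<int>}"
    by (rule countable_subset) auto
  then show ?thesis unfolding lattice_def by auto
qed

section \<open>Duality of the two lattices\<close>

lemma dual_lattice_inner_mult:
  fixes A :: "real^'n^'n"
  assumes "invertible A"
  shows "(matrix_inv (transpose A) *v w) \<bullet> (A *v z) = w \<bullet> z"
proof -
  have "(matrix_inv (transpose A) *v w) \<bullet> (A *v z) = (transpose A *v (matrix_inv (transpose A) *v w)) \<bullet> z"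
    by (simp add: dot_lmul_matrix)
  also have "\<dots> = w \<bullet> z"
    using matrix_inv_self(1)[OF transpose_invertible[OF assms]]
    by (metis matrix_vector_mul_assoc matrix_vector_mul_lid)
  finally show ?thesis .
qed

lemma dual_lattice_inner_Ints:
  fixes A :: "real^'n^'n"
  assumes "invertible A" "\<kappa> \<in> dual_lattice A" "l \<in> lattice A"
  shows "\<kappa> \<bullet> l \<in> \<int>"
proof -
  obtain w z where "\<kappa> = matrix_inv (transpose A) *v w" "l = A *v z" "\<And>i. w $ i \<in> \<int>" "\<And>i. z $ i \<in> \<int>"
    using assms(2,3) unfolding dual_lattice_def lattice_def by auto
  then show ?thesis
    by (simp add: dual_lattice_inner_mult[OF assms(1)]) (simp add: inner_vec_def Ints_sum Ints_mult)
qed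

text \<open>The columns of the inverse transpose of \<open>A\<close>: pairing a vector with them
  reads off its coordinates with respect to the columns of \<open>A\<close>.\<close>

definition dual_basis :: "real^'n^'n \<Rightarrow> 'n \<Rightarrow> real^'n"
  where "dual_basis A i = matrix_inv (transpose A) *v axis i 1"

lemma dual_basis_in: "dual_basis A i \<in> dual_lattice A"
  unfolding dual_basis_def dual_lattice_def lattice_def by (auto simp: axis_def)

text \<open>A converse of \<open>dual_lattice_inner_Ints\<close> that tests finitely many dual
  vectors only. It makes the torus map injective modulo the lattice.\<close>

lemma dual_basis_detects_lattice:
  fixes A :: "real^'n^'n"
  assumes "invertible A" "\<And>i. dual_basis A i \<bullet> x \<in> \<int>"
  shows "x \<in> lattice A"
proof -
  let ?z = "matrix_inv A *v x"
  have x: "x = A *v ?z"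
    using matrix_inv_self(1)[OF assms(1)] by (metis matrix_vector_mul_assoc matrix_vector_mul_lid)
  have "dual_basis A i \<bullet> x = ?z $ i" for i
    unfolding dual_basis_def by (subst x, subst dual_lattice_inner_mult[OF assms(1)]) (simp add: inner_axis')
  then show ?thesis using assms(2) x unfolding lattice_def by auto
qed

lemma dual_lattice_diff: "x \<in> dual_lattice A \<Longrightarrow> y \<in> dual_lattice A \<Longrightarrow> x - y \<in> dual_lattice A"
  unfolding dual_lattice_def by (rule lattice_diff)

section \<open>Lebesgue measure under translations\<close>

lemma emeasure_translation: "emeasure lebesgue ((+) a ` S) = emeasure lebesgue S"
  for a :: "real^'n"
  using emeasure_lebesgue_affine[of 1 a S] by (simp add: add.commute)

text \<open>Moves the translation from one set to the other, which exchanges cutting \<Omega> along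
  translates of a set for cutting that set along translates of \<Omega>.\<close>

lemma emeasure_Int_translation:
  "emeasure lebesgue (T \<inter> (+) a ` S) = emeasure lebesgue (S \<inter> (+) (- a) ` T)"
  for a :: "real^'n"
proof -
  have "(+) a ` (S \<inter> (+) (- a) ` T) = (+) a ` S \<inter> (+) a ` (+) (- a) ` T"
    by (rule image_Int) simp
  then have "T \<inter> (+) a ` S = (+) a ` (S \<inter> (+) (- a) ` T)"
    by (simp add: image_image Int_commute)
  then show ?thesis by (simp add: emeasure_translation)
qed

section \<open>Reduction modulo the lattice as a measure preserving map\<close>

locale lattice_domain =
  fixes A :: "real^'n^'n" and \<Omega> :: "(real^'n) set"
  assumes inv: "invertible A" and fd: "fundamental_domain (lattice A) \<Omega>"
begin

text \<open>This names the choice inside \<open>periodic_extension\<close>, so that the periodic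
  extension of f is f composed with \<open>rep\<close>.\<close>

definition rep :: "real^'n \<Rightarrow> real^'n"
  where "rep x = (THE \<omega>. \<omega> \<in> \<Omega> \<and> x - \<omega> \<in> lattice A)"

lemma dom_sets [measurable, simp]: "\<Omega> \<in> sets lebesgue"
  using fd by (simp add: fundamental_domain_def)

lemma ex1_rep: "\<exists>!\<omega>. \<omega> \<in> \<Omega> \<and> x - \<omega> \<in> lattice A"
proof -
  have "\<exists>!p. p \<in> \<Omega> \<times> lattice A \<and> x = fst p + snd p"
    using fd by (simp add: fundamental_domain_def)
  then obtain p where p: "p \<in> \<Omega> \<times> lattice A" "x = fst p + snd p"
    and u: "\<And>q. q \<in> \<Omega> \<times> lattice A \<Longrightarrow> x = fst q + snd q \<Longrightarrow> q = p" by blast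
  show ?thesis
  proof (rule ex1I[where a = "fst p"])
    show "fst p \<in> \<Omega> \<and> x - fst p \<in> lattice A" using p by (auto simp: mem_Times_iff)
    fix \<omega> assume "\<omega> \<in> \<Omega> \<and> x - \<omega> \<in> lattice A"
    then show "\<omega> = fst p" using u[of "(\<omega>, x - \<omega>)"] by auto
  qed
qed

lemma rep_in: "rep x \<in> \<Omega>" and rep_diff: "x - rep x \<in> lattice A"
  using theI'[OF ex1_rep[of x]] unfolding rep_def by auto

lemma rep_eqI: "\<omega> \<in> \<Omega> \<Longrightarrow> x - \<omega> \<in> lattice A \<Longrightarrow> rep x = \<omega>"
  using ex1_rep[of x] rep_in[of x] rep_diff[of x] by blast

lemma rep_ident: "x \<in> \<Omega> \<Longrightarrow> rep x = x"
  by (rule rep_eqI) auto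

lemma periodic_extension_rep: "periodic_extension (lattice A) \<Omega> f x = f (rep x)"
  by (simp add: periodic_extension_def rep_def)

lemma rep_vimage: "S \<subseteq> \<Omega> \<Longrightarrow> rep x \<in> S \<longleftrightarrow> (\<exists>l\<in>lattice A. x - l \<in> S)"
proof
  assume "S \<subseteq> \<Omega>" "\<exists>l\<in>lattice A. x - l \<in> S"
  then obtain l where "l \<in> lattice A" "x - l \<in> S" by blast
  then show "rep x \<in> S" using rep_eqI[of "x - l" x] \<open>S \<subseteq> \<Omega>\<close> by auto
qed (metis diff_diff_eq2 add_diff_cancel_left' rep_diff)

lemma vimage_shift_rep:
  assumes "S \<subseteq> \<Omega>"
  shows "(\<lambda>x. rep (x + h)) -` S = (\<Union>l\<in>lattice A. (+) (l - h) ` S)"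
proof -
  have "x + h - l \<in> S \<longleftrightarrow> x \<in> (+) (l - h) ` S" for x l
    by (auto simp: image_iff algebra_simps intro!: bexI[of _ "x + h - l"])
  then show ?thesis
    unfolding set_eq_iff vimage_def mem_Collect_eq rep_vimage[OF assms] by simp
qed

lemma shift_rep_sets:
  assumes "S \<subseteq> \<Omega>" "S \<in> sets lebesgue"
  shows "(\<lambda>x. rep (x + h)) -` S \<in> sets lebesgue"
  unfolding vimage_shift_rep[OF assms(1)]
  using assms(2) by (intro sets.countable_UN' countable_lattice) (auto intro: lebesgue_sets_translation)

text \<open>Preimages are countable unions of translates, so every Lebesgue set pulls back to a
  Lebesgue set, null sets of the completion included.\<close>

lemma measurable_shift_rep: "(\<lambda>x. rep (x + h)) \<in> lebesgue \<rightarrow>\<^sub>M lebesgue_on \<Omega>"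
proof (rule measurableI)
  fix S assume "S \<in> sets (lebesgue_on \<Omega>)"
  then have "S \<subseteq> \<Omega>" "S \<in> sets lebesgue"
    by (auto simp: sets_restrict_space)
  then show "(\<lambda>x. rep (x + h)) -` S \<inter> space lebesgue \<in> sets lebesgue"
    using shift_rep_sets by simp
qed (simp add: rep_in)

text \<open>Unfolding: the preimage is cut into the pieces \<Omega> \<inter> (S + l - h). Translated
  back they become S \<inter> (\<Omega> + h - l), and these tile S because the lattice translates of
  \<Omega> tile the space.\<close>

lemma emeasure_shift_rep:
  assumes S: "S \<subseteq> \<Omega>" "S \<in> sets lebesgue"
  shows "emeasure lebesgue (\<Omega> \<inter> (\<lambda>x. rep (x + h)) -` S) = emeasure lebesgue S"
proof -
  let ?L = "lattice A"
  have disj: "disjoint_family_on (\<lambda>l. \<Omega> \<inter> (+) (l - h) ` S) ?L"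
    unfolding disjoint_family_on_def
  proof (intro ballI impI equals0I)
    fix l m x assume lm: "l \<in> ?L" "m \<in> ?L" "l \<noteq> m"
      "x \<in> (\<Omega> \<inter> (+) (l - h) ` S) \<inter> (\<Omega> \<inter> (+) (m - h) ` S)"
    then obtain s t where st: "s \<in> S" "t \<in> S" "x = l - h + s" "x = m - h + t" by auto
    have "x + h - s = l" "x + h - t = m"
      using st(3,4) by (simp_all only: algebra_simps) simp_all
    then have "rep (x + h) = s" "rep (x + h) = t"
      using st S lm by (auto intro!: rep_eqI)
    then show False using st lm by simp
  qed
  have disj': "disjoint_family_on (\<lambda>l. S \<inter> (+) (h - l) ` \<Omega>) ?L"
    unfolding disjoint_family_on_def
  proof (intro ballI impI equals0I)
    fix l m x assume lm: "l \<in> ?L" "m \<in> ?L" "l \<noteq> m"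
      "x \<in> (S \<inter> (+) (h - l) ` \<Omega>) \<inter> (S \<inter> (+) (h - m) ` \<Omega>)"
    then obtain s t where st: "s \<in> \<Omega>" "t \<in> \<Omega>" "x = h - l + s" "x = h - m + t" by auto
    have "x - h - s = - l" "x - h - t = - m"
      by (simp add: st(3), simp add: st(4))
    then have "rep (x - h) = s" "rep (x - h) = t"
      using st(1,2) lm(1,2) by (auto intro!: rep_eqI lattice_minus)
    then show False using st lm by simp
  qed
  have "\<Omega> \<inter> (\<lambda>x. rep (x + h)) -` S = (\<Union>l\<in>?L. \<Omega> \<inter> (+) (l - h) ` S)"
    unfolding vimage_shift_rep[OF S(1)] by auto
  then have "emeasure lebesgue (\<Omega> \<inter> (\<lambda>x. rep (x + h)) -` S) =
      (\<integral>\<^sup>+l. emeasure lebesgue (\<Omega> \<inter> (+) (l - h) ` S) \<partial>count_space ?L)"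
    using S(2) by (simp only:) (subst emeasure_UN_countable[OF _ countable_lattice disj], auto intro!: lebesgue_sets_translation)
  also have "\<dots> = (\<integral>\<^sup>+l. emeasure lebesgue (S \<inter> (+) (h - l) ` \<Omega>) \<partial>count_space ?L)"
    using emeasure_Int_translation[of \<Omega> "_ - h" S] by (intro nn_integral_cong) simp
  also have "\<dots> = emeasure lebesgue (\<Union>l\<in>?L. S \<inter> (+) (h - l) ` \<Omega>)"
    using S(2) by (subst emeasure_UN_countable[OF _ countable_lattice disj']) (auto intro!: lebesgue_sets_translation)
  also have "(\<Union>l\<in>?L. S \<inter> (+) (h - l) ` \<Omega>) = S"
  proof -
    have "x \<in> (\<Union>l\<in>?L. (+) (h - l) ` \<Omega>)" for x
      using rep_in[of "x - h"] lattice_minus[OF rep_diff[of "x - h"]]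
      by (auto intro!: bexI[of _ "- (x - h - rep (x - h))"] image_eqI[of _ _ "rep (x - h)"])
    then show ?thesis by blast
  qed
  finally show ?thesis .
qed

lemma distr_shift_rep: "distr (lebesgue_on \<Omega>) (lebesgue_on \<Omega>) (\<lambda>x. rep (x + h)) = lebesgue_on \<Omega>"
proof (rule measure_eqI)
  have m: "(\<lambda>x. rep (x + h)) \<in> lebesgue_on \<Omega> \<rightarrow>\<^sub>M lebesgue_on \<Omega>"
    using measurable_shift_rep by (rule measurable_restrict_space1)
  fix S assume "S \<in> sets (distr (lebesgue_on \<Omega>) (lebesgue_on \<Omega>) (\<lambda>x. rep (x + h)))"
  then have S: "S \<in> sets (lebesgue_on \<Omega>)" by simp
  then have S': "S \<subseteq> \<Omega>" "S \<in> sets lebesgue" by (auto simp: sets_restrict_space)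
  show "emeasure (distr (lebesgue_on \<Omega>) (lebesgue_on \<Omega>) (\<lambda>x. rep (x + h))) S = emeasure (lebesgue_on \<Omega>) S"
    using S S' m by (simp add: emeasure_distr emeasure_restrict_space Int_commute emeasure_shift_rep)
qed simp

text \<open>\<Omega> may be unbounded, so it is compared with the image of the unit cube under
  \<open>A\<close>. Translates of this cell cover \<Omega>, and the pieces moved back into the cell
  stay disjoint, since translates of \<Omega> do not overlap.\<close>

lemma emeasure_dom_finite: "emeasure lebesgue \<Omega> < \<infinity>"
proof -
  let ?L = "lattice A" and ?Q = "(\<lambda>x. A *v x) ` cbox 0 1"
  have cQ: "compact ?Q"
    by (intro compact_continuous_image compact_cbox matrix_vector_mult_linear_continuous_on)
  then have Q: "?Q \<in> sets lebesgue" "emeasure lebesgue ?Q < \<infinity>"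
    using lmeasurable_compact[OF cQ] by (auto simp: fmeasurable_def)
  have cover: "\<exists>l\<in>?L. x \<in> (+) l ` ?Q" for x
  proof -
    let ?z = "matrix_inv A *v x"
    have x: "x = A *v ?z"
      using matrix_inv_self(1)[OF inv] by (metis matrix_vector_mul_assoc matrix_vector_mul_lid)
    let ?f = "(\<chi> i. of_int \<lfloor>?z $ i\<rfloor>) :: real^'n"
    have "A *v ?f \<in> ?L" by (auto simp: lattice_def)
    moreover have "x = A *v ?f + A *v (?z - ?f)"
      by (subst x) (simp flip: matrix_vector_right_distrib)
    moreover have "?z - ?f \<in> cbox 0 1"
    proof -
      have "r - of_int \<lfloor>r\<rfloor> \<le> 1" for r :: real by linarith
      then show ?thesis by (simp add: mem_box_cart)
    qed
    ultimately show ?thesis by blast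
  qed
  have disj: "disjoint_family_on (\<lambda>l. ?Q \<inter> (+) (- l) ` \<Omega>) ?L"
    unfolding disjoint_family_on_def
  proof (intro ballI impI equals0I)
    fix l m x assume lm: "l \<in> ?L" "m \<in> ?L" "l \<noteq> m"
      "x \<in> (?Q \<inter> (+) (- l) ` \<Omega>) \<inter> (?Q \<inter> (+) (- m) ` \<Omega>)"
    then obtain s t where st: "s \<in> \<Omega>" "t \<in> \<Omega>" "x = - l + s" "x = - m + t" by blast
    have "x - s = - l" "x - t = - m"
      by (simp add: st(3), simp add: st(4))
    then have "rep x = s" "rep x = t"
      using st(1,2) lm(1,2) by (auto intro!: rep_eqI lattice_minus)
    then show False using st lm by simp
  qed
  have "emeasure lebesgue \<Omega> = (\<integral>\<^sup>+x. indicator \<Omega> x \<partial>lebesgue)"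
    by simp
  \<comment> \<open>The closed cells overlap on their faces, so points of \<Omega> are counted with
    multiplicity and only an inequality results.\<close>
  also have "\<dots> \<le> (\<integral>\<^sup>+x. (\<integral>\<^sup>+l. indicator (\<Omega> \<inter> (+) l ` ?Q) x \<partial>count_space ?L) \<partial>lebesgue)"
  proof (rule nn_integral_mono)
    fix x
    obtain l where l: "l \<in> ?L" "x \<in> (+) l ` ?Q" using cover by blast
    show "indicator \<Omega> x \<le> (\<integral>\<^sup>+l. indicator (\<Omega> \<inter> (+) l ` ?Q) x \<partial>count_space ?L)"
      using nn_integral_ge_point[OF l(1), of "\<lambda>l. indicator (\<Omega> \<inter> (+) l ` ?Q) x"] l(2)
      by (auto simp: indicator_def)
  qed
  also have "\<dots> = (\<integral>\<^sup>+l. emeasure lebesgue (\<Omega> \<inter> (+) l ` ?Q) \<partial>count_space ?L)"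
    using Q(1) by (subst nn_integral_count_space_nn_integral)
      (auto intro!: countable_lattice nn_integral_cong nn_integral_indicator borel_measurable_indicator
        lebesgue_sets_translation)
  also have "\<dots> = (\<integral>\<^sup>+l. emeasure lebesgue (?Q \<inter> (+) (- l) ` \<Omega>) \<partial>count_space ?L)"
    by (intro nn_integral_cong emeasure_Int_translation)
  also have "\<dots> = emeasure lebesgue (\<Union>l\<in>?L. ?Q \<inter> (+) (- l) ` \<Omega>)"
    by (rule emeasure_UN_countable[OF _ countable_lattice disj, symmetric])
      (intro sets.Int lebesgue_sets_translation dom_sets Q(1))
  also have "\<dots> \<le> emeasure lebesgue ?Q"
    using Q(1) by (intro emeasure_mono) auto
  finally show ?thesis using Q(2) by simp
qed

text \<open>Otherwise countably many null translates would cover the space. Positivity justifies the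
  divisions by the volume.\<close>

lemma measure_dom_pos: "measure lebesgue \<Omega> > 0"
proof (rule ccontr)
  assume "\<not> measure lebesgue \<Omega> > 0"
  then have "emeasure lebesgue \<Omega> = 0"
    using emeasure_dom_finite by (simp add: emeasure_eq_ennreal_measure zero_less_measure_iff less_top)
  then have "(+) l ` \<Omega> \<in> null_sets lebesgue" for l
    by (auto simp: null_sets_def emeasure_translation lebesgue_sets_translation)
  then have "(\<Union>l\<in>lattice A. (+) l ` \<Omega>) \<in> null_sets lebesgue"
    by (intro null_sets_UN' countable_lattice)
  moreover have "(\<Union>l\<in>lattice A. (+) l ` \<Omega>) = UNIV"
  proof -
    have "x \<in> (\<Union>l\<in>lattice A. (+) l ` \<Omega>)" for x
      using rep_in[of x] rep_diff[of x] by (auto intro!: bexI[of _ "x - rep x"] image_eqI[of _ _ "rep x"])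
    then show ?thesis by blast
  qed
  ultimately show False by (simp add: null_sets_def)
qed

end

section \<open>Characters, Bessel inequality and the Riesz-Fischer theorem\<close>

text \<open>The sign is opposite to that in \<open>fourier_coeff\<close>, so the coefficients are
  integrals against \<open>cnj (chr \<kappa> x)\<close>, that is, inner products with
  characters.\<close>

definition chr :: "real^'n \<Rightarrow> real^'n \<Rightarrow> complex"
  where "chr \<kappa> x = cis (2 * pi * (\<kappa> \<bullet> x))"

lemma norm_chr [simp]: "norm (chr \<kappa> x) = 1"
  by (simp add: chr_def)

lemma chr_zero [simp]: "chr 0 x = 1" "chr \<kappa> 0 = 1"
  by (simp_all add: chr_def)

lemma chr_add_left: "chr (\<kappa> + \<mu>) x = chr \<kappa> x * chr \<mu> x"
  by (simp add: chr_def cis_mult inner_add_left algebra_simps)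

lemma chr_add: "chr \<kappa> (x + y) = chr \<kappa> x * chr \<kappa> y"
  by (simp add: chr_def cis_mult inner_add_right algebra_simps)

lemma cnj_chr: "cnj (chr \<kappa> x) = chr (- \<kappa>) x"
  by (simp add: chr_def cis_cnj)

lemma chr_mult_cnj: "chr \<kappa> x * cnj (chr \<mu> x) = chr (\<kappa> - \<mu>) x"
  by (simp add: cnj_chr flip: chr_add_left)

lemma chr_Ints: "\<kappa> \<bullet> x \<in> \<int> \<Longrightarrow> chr \<kappa> x = 1"
  unfolding chr_def by (rule cis_multiple_2pi)

lemma chr_eq_1_iff: "chr \<kappa> x = 1 \<longleftrightarrow> \<kappa> \<bullet> x \<in> \<int>"
proof
  assume "chr \<kappa> x = 1"
  then have "cos (2 * pi * (\<kappa> \<bullet> x)) = 1" by (simp add: chr_def complex_eq_iff)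
  then obtain n :: int where "2 * pi * (\<kappa> \<bullet> x) = n * 2 * pi" by (auto simp: cos_one_2pi_int)
  then have "\<kappa> \<bullet> x = n" by simp
  then show "\<kappa> \<bullet> x \<in> \<int>" by simp
qed (rule chr_Ints)

lemma continuous_on_chr [continuous_intros]: "continuous_on S (chr \<kappa>)"
  unfolding chr_def by (intro continuous_intros)

lemma measurable_chr [measurable]: "chr \<kappa> \<in> borel_measurable (lebesgue_on S)"
proof -
  have "chr \<kappa> \<in> borel_measurable lebesgue"
    using borel_measurable_continuous_onI[OF continuous_on_chr, of \<kappa>] by (simp add: measurable_completion)
  then show ?thesis by (rule measurable_restrict_space1)
qed

lemma fourier_coeff_chr:
  "fourier_coeff \<Omega> f \<kappa> = (\<integral>x. f x * cnj (chr \<kappa> x) \<partial>lebesgue_on \<Omega>) / of_real (measure lebesgue \<Omega>)"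
  by (simp add: fourier_coeff_def chr_def cis_cnj)

lemma measurable_cnj [measurable (raw)]:
  "f \<in> borel_measurable M \<Longrightarrow> (\<lambda>x. cnj (f x)) \<in> borel_measurable M"
  by (erule measurable_compose[OF _ borel_measurable_continuous_onI]) (rule continuous_on_cnj[OF continuous_on_id])

text \<open>The family \<open>c\<close> covers all frequencies and only the index set
  \<open>F\<close> varies, so one fixed series can be summed over growing sets.\<close>

definition trig_poly :: "(real^'n \<Rightarrow> complex) \<Rightarrow> (real^'n) set \<Rightarrow> real^'n \<Rightarrow> complex"
  where "trig_poly c F x = (\<Sum>\<kappa>\<in>F. c \<kappa> * chr \<kappa> x)"

lemma norm_trig_poly_le: "norm (trig_poly c F x) \<le> (\<Sum>\<kappa>\<in>F. norm (c \<kappa>))"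
  unfolding trig_poly_def by (rule order.trans[OF norm_sum]) (simp add: norm_mult)

lemma measurable_trig_poly [measurable]: "trig_poly c F \<in> borel_measurable (lebesgue_on S)"
  unfolding trig_poly_def[abs_def] by measurable

lemma L2_spaceD:
  assumes "f \<in> L2_space \<Omega>"
  shows "f \<in> borel_measurable (lebesgue_on \<Omega>)" "integrable (lebesgue_on \<Omega>) (\<lambda>x. (cmod (f x))\<^sup>2)"
  using assms by (auto simp: L2_space_def)

text \<open>The bound a b \<le> a^2 + b^2 replaces the Cauchy-Schwarz inequality, as only
  integrability is at stake.\<close>

lemma L2_space_integrable_mult:
  assumes "f \<in> L2_space \<Omega>" "g \<in> L2_space \<Omega>"
  shows "integrable (lebesgue_on \<Omega>) (\<lambda>x. f x * cnj (g x))"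
proof (rule Bochner_Integration.integrable_bound)
  show "integrable (lebesgue_on \<Omega>) (\<lambda>x. (cmod (f x))\<^sup>2 + (cmod (g x))\<^sup>2)"
    using assms by (intro Bochner_Integration.integrable_add) (auto dest: L2_spaceD)
  show "(\<lambda>x. f x * cnj (g x)) \<in> borel_measurable (lebesgue_on \<Omega>)"
    using assms[THEN L2_spaceD(1)] by measurable
  have "a * b \<le> a\<^sup>2 + b\<^sup>2" if "a \<ge> 0" "b \<ge> 0" for a b :: real
    using sum_squares_bound[of a b] mult_nonneg_nonneg[OF that] by linarith
  then show "AE x in lebesgue_on \<Omega>. norm (f x * cnj (g x)) \<le> norm ((cmod (f x))\<^sup>2 + (cmod (g x))\<^sup>2)"
    by (auto simp: norm_mult)
qed

lemma L2_space_diff: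
  assumes "f \<in> L2_space \<Omega>" "g \<in> L2_space \<Omega>"
  shows "(\<lambda>x. f x - g x) \<in> L2_space \<Omega>"
proof -
  note [measurable] = assms[THEN L2_spaceD(1)]
  have "integrable (lebesgue_on \<Omega>) (\<lambda>x. (cmod (f x - g x))\<^sup>2)"
  proof (rule Bochner_Integration.integrable_bound)
    show "integrable (lebesgue_on \<Omega>) (\<lambda>x. 2 * (cmod (f x))\<^sup>2 + 2 * (cmod (g x))\<^sup>2)"
      using assms by (intro Bochner_Integration.integrable_add integrable_mult_right) (auto dest: L2_spaceD)
    show "(\<lambda>x. (cmod (f x - g x))\<^sup>2) \<in> borel_measurable (lebesgue_on \<Omega>)"
      by measurable
    have "(cmod (a - b))\<^sup>2 \<le> 2 * (cmod a)\<^sup>2 + 2 * (cmod b)\<^sup>2" for a b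
    proof -
      have "(cmod (a - b))\<^sup>2 \<le> (cmod a + cmod b)\<^sup>2"
        by (intro power_mono norm_triangle_ineq4) simp
      also have "\<dots> \<le> 2 * (cmod a)\<^sup>2 + 2 * (cmod b)\<^sup>2"
        using sum_squares_bound[of "cmod a" "cmod b"] by (simp add: power2_sum)
      finally show ?thesis .
    qed
    then show "AE x in lebesgue_on \<Omega>. norm ((cmod (f x - g x))\<^sup>2) \<le> norm (2 * (cmod (f x))\<^sup>2 + 2 * (cmod (g x))\<^sup>2)"
      by auto
  qed
  then show ?thesis by (simp add: L2_space_def)
qed

section \<open>Square-integrable functions on the fundamental domain\<close>

context lattice_domain
begin

abbreviation "D \<equiv> dual_lattice A"
abbreviation "M \<equiv> lebesgue_on \<Omega>"
abbreviation "vol \<equiv> measure lebesgue \<Omega>"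

sublocale finite_measure M
  using emeasure_dom_finite by (intro finite_measure_lebesgue_on) (simp add: fmeasurable_def)

lemma measure_M [simp]: "measure M \<Omega> = vol"
  by (simp add: measure_restrict_space)

lemma bounded_L2: "f \<in> borel_measurable M \<Longrightarrow> (\<And>x. norm (f x) \<le> B) \<Longrightarrow> f \<in> L2_space \<Omega>"
  unfolding L2_space_def
  by (auto intro!: integrable_const_bound[where B = "B\<^sup>2"] AE_I2 power_mono)

lemma chr_L2: "chr \<kappa> \<in> L2_space \<Omega>"
  by (rule bounded_L2[where B = 1]) auto

lemma trig_poly_L2: "trig_poly c F \<in> L2_space \<Omega>"
  by (rule bounded_L2[OF _ norm_trig_poly_le]) measurable

text \<open>The product of f with the constant function \<open>chr 0\<close> is integrable.\<close>

lemma L2_integrable: "f \<in> L2_space \<Omega> \<Longrightarrow> integrable M f"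
  using L2_space_integrable_mult[of f \<Omega> "chr 0"] chr_L2 by simp

lemma chr_rep: "\<kappa> \<in> D \<Longrightarrow> chr \<kappa> (rep x) = chr \<kappa> x"
  using chr_add[of \<kappa> "rep x" "x - rep x"] chr_Ints[OF dual_lattice_inner_Ints[OF inv _ rep_diff]] by simp

lemma measurable_shift_rep': "(\<lambda>x. rep (x + h)) \<in> M \<rightarrow>\<^sub>M M"
  using measurable_shift_rep by (rule measurable_restrict_space1)

lemma integral_shift_rep:
  fixes f :: "real^'n \<Rightarrow> 'b :: {banach, second_countable_topology}"
  assumes "f \<in> borel_measurable M"
  shows "(\<integral>x. f (rep (x + h)) \<partial>M) = (\<integral>x. f x \<partial>M)"
  using integral_distr[OF measurable_shift_rep' assms, of h] by (simp add: distr_shift_rep)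

lemma integrable_shift_rep:
  fixes f :: "real^'n \<Rightarrow> 'b :: {banach, second_countable_topology}"
  assumes "integrable M f"
  shows "integrable M (\<lambda>x. f (rep (x + h)))"
  using integrable_distr[OF measurable_shift_rep'[of h], where f = f] assms by (simp add: distr_shift_rep)

text \<open>A shift by h preserves the integral but multiplies the character by its value at h. If
  that value is -1, the integral equals its own negative.\<close>

lemma integral_chr:
  assumes "\<kappa> \<in> D" "\<kappa> \<noteq> 0"
  shows "(\<integral>x. chr \<kappa> x \<partial>M) = 0"
proof -
  \<comment> \<open>The scaling gives \<kappa> \<bullet> h = 1/2, half a period of the
    character.\<close>
  define h where "h = (1 / (2 * (norm \<kappa>)\<^sup>2)) *\<^sub>R \<kappa>"
  have "\<kappa> \<bullet> h = 1 / 2"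
    using assms(2) by (simp add: h_def dot_square_norm)
  then have "2 * pi * (\<kappa> \<bullet> h) = pi" by simp
  then have h: "chr \<kappa> h = -1" by (simp only: chr_def cis_pi)
  have "(\<integral>x. chr \<kappa> x \<partial>M) = (\<integral>x. chr \<kappa> (rep (x + h)) \<partial>M)"
    by (rule integral_shift_rep[symmetric]) measurable
  also have "\<dots> = - (\<integral>x. chr \<kappa> x \<partial>M)"
    by (simp add: chr_rep assms chr_add h)
  finally show ?thesis by simp
qed

lemma integral_chr_mult_cnj:
  assumes "\<kappa> \<in> D" "\<mu> \<in> D"
  shows "(\<integral>x. chr \<kappa> x * cnj (chr \<mu> x) \<partial>M) = (if \<kappa> = \<mu> then of_real vol else 0)"
  using integral_chr[OF dual_lattice_diff[OF assms]] by (auto simp: chr_mult_cnj scaleR_conv_of_real)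

lemma integral_mult_cnj_chr:
  "(\<integral>x. f x * cnj (chr \<kappa> x) \<partial>M) = of_real vol * fourier_coeff \<Omega> f \<kappa>"
  using measure_dom_pos by (simp add: fourier_coeff_chr)

lemma integrable_mult_chr: "integrable M f \<Longrightarrow> integrable M (\<lambda>x. f x * cnj (chr \<kappa> x))"
  by (rule Bochner_Integration.integrable_bound[of M f]) (auto simp: norm_mult)

lemma fourier_coeff_diff:
  assumes "integrable M f" "integrable M g"
  shows "fourier_coeff \<Omega> (\<lambda>x. f x - g x) \<kappa> = fourier_coeff \<Omega> f \<kappa> - fourier_coeff \<Omega> g \<kappa>"
  using assms[THEN integrable_mult_chr, of \<kappa>]
  by (simp add: fourier_coeff_chr left_diff_distrib diff_divide_distrib)

lemma integral_mult_cnj_trig_poly: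
  assumes "f \<in> L2_space \<Omega>"
  shows "(\<integral>x. f x * cnj (trig_poly c F x) \<partial>M) = of_real vol * (\<Sum>\<kappa>\<in>F. fourier_coeff \<Omega> f \<kappa> * cnj (c \<kappa>))"
proof -
  have "(\<integral>x. f x * cnj (trig_poly c F x) \<partial>M) = (\<integral>x. (\<Sum>\<kappa>\<in>F. cnj (c \<kappa>) * (f x * cnj (chr \<kappa> x))) \<partial>M)"
    by (simp add: trig_poly_def sum_distrib_left algebra_simps)
  also have "\<dots> = (\<Sum>\<kappa>\<in>F. cnj (c \<kappa>) * (\<integral>x. f x * cnj (chr \<kappa> x) \<partial>M))"
    using L2_space_integrable_mult[OF assms chr_L2] by (subst Bochner_Integration.integral_sum) auto
  finally show ?thesis by (simp add: integral_mult_cnj_chr sum_distrib_left algebra_simps)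
qed

lemma fourier_coeff_trig_poly:
  assumes "finite F" "F \<subseteq> D" "\<kappa> \<in> D"
  shows "fourier_coeff \<Omega> (trig_poly c F) \<kappa> = (if \<kappa> \<in> F then c \<kappa> else 0)"
proof -
  have "(\<integral>x. trig_poly c F x * cnj (chr \<kappa> x) \<partial>M) = (\<integral>x. (\<Sum>\<mu>\<in>F. c \<mu> * (chr \<mu> x * cnj (chr \<kappa> x))) \<partial>M)"
    by (simp add: trig_poly_def sum_distrib_right mult.assoc)
  also have "\<dots> = (\<Sum>\<mu>\<in>F. c \<mu> * (\<integral>x. chr \<mu> x * cnj (chr \<kappa> x) \<partial>M))"
    using L2_space_integrable_mult[OF chr_L2 chr_L2] by (subst Bochner_Integration.integral_sum) auto
  also have "\<dots> = (\<Sum>\<mu>\<in>F. if \<mu> = \<kappa> then c \<mu> * of_real vol else 0)"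
    using assms by (intro sum.cong) (auto simp: integral_chr_mult_cnj)
  also have "\<dots> = of_real vol * (if \<kappa> \<in> F then c \<kappa> else 0)"
    using assms(1) by (simp add: sum.delta')
  finally show ?thesis using measure_dom_pos by (simp add: fourier_coeff_chr)
qed

lemma integral_norm_trig_poly:
  assumes "finite F" "F \<subseteq> D"
  shows "(\<integral>x. (cmod (trig_poly c F x))\<^sup>2 \<partial>M) = vol * (\<Sum>\<kappa>\<in>F. (cmod (c \<kappa>))\<^sup>2)"
proof -
  have "of_real (\<integral>x. (cmod (trig_poly c F x))\<^sup>2 \<partial>M) = (\<integral>x. trig_poly c F x * cnj (trig_poly c F x) \<partial>M)"
    by (simp flip: integral_complex_of_real complex_norm_square)
  also have "\<dots> = of_real vol * (\<Sum>\<kappa>\<in>F. c \<kappa> * cnj (c \<kappa>))"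
    using assms by (subst integral_mult_cnj_trig_poly[OF trig_poly_L2]) (auto intro!: sum.cong simp: fourier_coeff_trig_poly subset_iff)
  also have "\<dots> = of_real (vol * (\<Sum>\<kappa>\<in>F. (cmod (c \<kappa>))\<^sup>2))"
    by (simp flip: complex_norm_square)
  finally show ?thesis by (simp only: of_real_eq_iff)
qed

text \<open>The squared norm of f minus its partial Fourier sum is nonnegative; expand it.\<close>

lemma bessel:
  assumes "f \<in> L2_space \<Omega>" "finite F" "F \<subseteq> D"
  shows "(\<Sum>\<kappa>\<in>F. (cmod (fourier_coeff \<Omega> f \<kappa>))\<^sup>2) \<le> (\<integral>x. (cmod (f x))\<^sup>2 \<partial>M) / vol"
proof -
  let ?c = "fourier_coeff \<Omega> f"
  let ?s = "trig_poly ?c F"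
  let ?S = "\<Sum>\<kappa>\<in>F. (cmod (?c \<kappa>))\<^sup>2"
  have i1: "integrable M (\<lambda>x. (cmod (f x))\<^sup>2)" and i3: "integrable M (\<lambda>x. (cmod (?s x))\<^sup>2)"
    using L2_spaceD(2)[OF assms(1)] L2_spaceD(2)[OF trig_poly_L2] by auto
  have i2: "integrable M (\<lambda>x. 2 * Re (f x * cnj (?s x)))"
    by (intro integrable_mult_right integrable_Re L2_space_integrable_mult assms(1) trig_poly_L2)
  have "0 \<le> (\<integral>x. (cmod (f x - ?s x))\<^sup>2 \<partial>M)" by simp
  also have "\<dots> = (\<integral>x. (cmod (f x))\<^sup>2 - 2 * Re (f x * cnj (?s x)) + (cmod (?s x))\<^sup>2 \<partial>M)"
  proof -
    have "(cmod (a - b))\<^sup>2 = (cmod a)\<^sup>2 - 2 * Re (a * cnj b) + (cmod b)\<^sup>2" for a b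
      unfolding cmod_power2 by (simp add: power2_eq_square algebra_simps)
    then show ?thesis by simp
  qed
  also have "\<dots> = (\<integral>x. (cmod (f x))\<^sup>2 \<partial>M) - 2 * (\<integral>x. Re (f x * cnj (?s x)) \<partial>M) + (\<integral>x. (cmod (?s x))\<^sup>2 \<partial>M)"
    by (simp only: Bochner_Integration.integral_add[OF Bochner_Integration.integrable_diff[OF i1 i2] i3]
        Bochner_Integration.integral_diff[OF i1 i2] integral_mult_right_zero)
  \<comment> \<open>Since \<open>?s\<close> carries the coefficients of f, the cross term equals the
    squared norm of \<open>?s\<close>, and the expansion leaves the squared norm of f minus
    \<open>vol * ?S\<close>.\<close>
  also have "(\<integral>x. Re (f x * cnj (?s x)) \<partial>M) = vol * ?S"
  proof -
    have "(\<integral>x. Re (f x * cnj (?s x)) \<partial>M) = Re (\<integral>x. f x * cnj (?s x) \<partial>M)"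
      by (rule integral_Re[OF L2_space_integrable_mult[OF assms(1) trig_poly_L2]])
    also have "(\<integral>x. f x * cnj (?s x) \<partial>M) = of_real (vol * ?S)"
      by (subst integral_mult_cnj_trig_poly[OF assms(1)]) (simp flip: complex_norm_square)
    finally show ?thesis by simp
  qed
  finally show ?thesis
    using measure_dom_pos by (simp add: integral_norm_trig_poly[OF assms(2,3)] field_simps)
qed

text \<open>The series is grouped into blocks with geometrically decaying L2 norm. It then converges
  absolutely almost everywhere, and Fatou's lemma bounds the norm of the limit.\<close>

lemma riesz_fischer:
  assumes bound: "\<And>F. finite F \<Longrightarrow> F \<subseteq> D \<Longrightarrow> (\<Sum>\<kappa>\<in>F. (cmod (c \<kappa>))\<^sup>2) \<le> B"
  obtains g where "g \<in> L2_space \<Omega>" "\<And>\<kappa>. \<kappa> \<in> D \<Longrightarrow> fourier_coeff \<Omega> g \<kappa> = c \<kappa>"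
    "(\<integral>x. (cmod (g x))\<^sup>2 \<partial>M) \<le> vol * B"
proof -
  define E where "E F = (\<Sum>\<kappa>\<in>F. (cmod (c \<kappa>))\<^sup>2)" for F
  let ?P = "{F. finite F \<and> F \<subseteq> D}"
  define S where "S = (SUP F\<in>?P. E F)"
  have bdd: "bdd_above (E ` ?P)"
    using bound by (auto simp: E_def intro!: bdd_aboveI)
  have E_le: "E F \<le> S" if "F \<in> ?P" for F
    unfolding S_def using that bdd by (intro cSUP_upper)
  \<comment> \<open>The error 4^(-k) bounds squared norms, so the blocks get norms of order 2^(-k),
    which is summable.\<close>
  have "\<exists>G\<in>?P. S - (1/4)^k < E G" for k
    using less_cSUP_iff[OF _ bdd, of "S - (1/4)^k"] by (auto simp: S_def)
  then obtain G where G: "\<And>k. G k \<in> ?P" "\<And>k. S - (1/4)^k < E (G k)" by metis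
  \<comment> \<open>The nearly maximal sets need not be nested. Their cumulative unions are, and
    they miss no more of the supremum.\<close>
  define F where "F k = (\<Union>j\<le>k. G j)" for k
  have F: "F k \<in> ?P" for k using G(1) by (auto simp: F_def)
  have F_mono: "F k \<subseteq> F (Suc k)" for k unfolding F_def by (rule UN_mono) auto
  have E_mono: "E X \<le> E Y" if "X \<subseteq> Y" "finite Y" for X Y
    unfolding E_def using that by (intro sum_mono2) auto
  have EF: "S - (1/4)^k < E (F k)" for k
    using G(2)[of k] E_mono[of "G k" "F k"] F[of k] by (force simp: F_def)
  \<comment> \<open>A finite set disjoint from \<open>F k\<close> cannot carry more than what
    \<open>F k\<close> lacks to the supremum \<open>S\<close>.\<close>
  have tail: "E X \<le> (1/4)^k" if "X \<in> ?P" "X \<inter> F k = {}" for X k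
  proof -
    have "E (F k) + E X = E (F k \<union> X)"
      unfolding E_def using that F[of k] by (intro sum.union_disjoint[symmetric]) auto
    also have "\<dots> \<le> S" using that F[of k] by (intro E_le) auto
    finally show ?thesis using EF[of k] by simp
  qed
  define u where "u k = trig_poly c (F (Suc k) - F k)" for k
  have u_L2: "u k \<in> L2_space \<Omega>" for k by (simp add: u_def trig_poly_L2)
  have [measurable]: "u k \<in> borel_measurable M" for k by (simp add: u_def)
  have u_int: "integrable M (u k)" for k by (rule L2_integrable[OF u_L2])
  have u_sum: "(\<Sum>j<k. u j x) = trig_poly c (F k) x - trig_poly c (F 0) x" for k x
  proof (induction k)
    case (Suc k)
    have "trig_poly c (F (Suc k)) x = u k x + trig_poly c (F k) x"
      unfolding u_def trig_poly_def using F_mono[of k] F[of "Suc k"] by (intro sum.subset_diff) auto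
    with Suc show ?case by simp
  qed simp
  have u_norm2: "(\<integral>x. (cmod (u k x))\<^sup>2 \<partial>M) \<le> vol * (1/4)^k" for k
    using F[of k] F[of "Suc k"] tail[of "F (Suc k) - F k" k]
    by (auto simp: u_def integral_norm_trig_poly subset_iff E_def intro!: mult_left_mono)
  \<comment> \<open>AM-GM \<open>2 t \<le> r + t\<^sup>2 / r\<close> with \<open>r = (1/2)^k\<close>\<close>
  have u_norm1: "(\<integral>x. cmod (u k x) \<partial>M) \<le> vol * (1/2)^k" for k
  proof -
    have "t \<le> (1/2)^k / 2 + 2^k / 2 * t\<^sup>2" for t :: real
    proof -
      have "0 \<le> 2^k * (t - (1/2)^k)\<^sup>2" by simp
      also have "\<dots> = 2^k * t\<^sup>2 - 2 * t + (1/2)^k"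
        by (simp add: power2_diff power2_eq_square power_one_over algebra_simps)
      finally show ?thesis by simp
    qed
    then have "(\<integral>x. cmod (u k x) \<partial>M) \<le> (\<integral>x. (1/2)^k / 2 + 2^k / 2 * (cmod (u k x))\<^sup>2 \<partial>M)"
      using L2_spaceD(2)[OF u_L2[of k]] u_int[of k]
      by (intro Bochner_Integration.integral_mono Bochner_Integration.integrable_add integrable_mult_right) auto
    also have "\<dots> = vol * (1/2)^k / 2 + 2^k / 2 * (\<integral>x. (cmod (u k x))\<^sup>2 \<partial>M)"
      using L2_spaceD(2)[OF u_L2[of k]] by (subst Bochner_Integration.integral_add) auto
    also have "\<dots> \<le> vol * (1/2)^k / 2 + 2^k / 2 * (vol * (1/4)^k)"
      by (intro add_left_mono mult_left_mono u_norm2) auto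
    also have "\<dots> = vol * (1/2)^k"
    proof -
      have "(4::real)^k = 2^k * 2^k" by (simp flip: power_mult_distrib)
      then show ?thesis by (simp add: power_divide field_simps)
    qed
    finally show ?thesis .
  qed
  have sum_bound: "summable (\<lambda>k. vol * (1/2)^k)"
    by (intro summable_mult summable_geometric) simp
  have summ: "summable (\<lambda>k. \<integral>x. cmod (u k x) \<partial>M)"
    by (rule summable_comparison_test'[OF sum_bound, of 0]) (use u_norm1 in auto)
  have AE_summ: "AE x in M. summable (\<lambda>k. norm (u k x))"
  proof -
    have "(\<integral>\<^sup>+x. (\<Sum>k. ennreal (norm (u k x))) \<partial>M) = (\<Sum>k. \<integral>\<^sup>+x. ennreal (norm (u k x)) \<partial>M)"
      by (rule nn_integral_suminf) measurable
    also have "\<dots> = (\<Sum>k. ennreal (\<integral>x. cmod (u k x) \<partial>M))"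
      using u_int by (intro suminf_cong nn_integral_eq_integral) auto
    also have "\<dots> \<noteq> \<infinity>"
      unfolding infinity_ennreal_def by (rule ennreal_suminf_neq_top[OF summ]) simp
    finally have "AE x in M. (\<Sum>k. ennreal (norm (u k x))) \<noteq> \<infinity>"
      by (intro nn_integral_PInf_AE) auto
    then show ?thesis
      by eventually_elim (auto intro: summable_suminf_not_top)
  qed
  \<comment> \<open>The blocks telescope from \<open>F 0\<close>, so the polynomial over
    \<open>F 0\<close> is added back.\<close>
  define g where "g x = trig_poly c (F 0) x + (\<Sum>k. u k x)" for x
  have sum_int: "integrable M (\<lambda>x. \<Sum>k. u k x)"
    by (rule integrable_suminf[OF u_int AE_summ summ])
  then have [measurable]: "g \<in> borel_measurable M"
    unfolding g_def[abs_def] by measurable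
  have g_int: "integrable M g"
    unfolding g_def[abs_def]
    by (rule Bochner_Integration.integrable_add[OF L2_integrable[OF trig_poly_L2] sum_int])
  have lim: "AE x in M. (\<lambda>k. trig_poly c (F k) x) \<longlonglongrightarrow> g x"
    using AE_summ
  proof eventually_elim
    case (elim x)
    have "(\<lambda>k. \<Sum>j<k. u j x) \<longlonglongrightarrow> (\<Sum>k. u k x)"
      by (rule summable_LIMSEQ[OF summable_norm_cancel[OF elim]])
    from tendsto_add[OF tendsto_const[of "trig_poly c (F 0) x"] this] show ?case
      by (simp add: u_sum g_def)
  qed
  have Fatou: "(\<integral>\<^sup>+x. ennreal ((cmod (g x))\<^sup>2) \<partial>M) \<le> ennreal (vol * B)"
  proof -
    have "(\<integral>\<^sup>+x. ennreal ((cmod (g x))\<^sup>2) \<partial>M) = (\<integral>\<^sup>+x. liminf (\<lambda>k. ennreal ((cmod (trig_poly c (F k) x))\<^sup>2)) \<partial>M)"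
    proof (rule nn_integral_cong_AE)
      show "AE x in M. ennreal ((cmod (g x))\<^sup>2) = liminf (\<lambda>k. ennreal ((cmod (trig_poly c (F k) x))\<^sup>2))"
        using lim
      proof eventually_elim
        case (elim x)
        then have "(\<lambda>k. ennreal ((cmod (trig_poly c (F k) x))\<^sup>2)) \<longlonglongrightarrow> ennreal ((cmod (g x))\<^sup>2)"
          by (intro tendsto_intros)
        from lim_imp_Liminf[OF sequentially_bot this] show ?case by (rule sym)
      qed
    qed
    also have "\<dots> \<le> liminf (\<lambda>k. \<integral>\<^sup>+x. ennreal ((cmod (trig_poly c (F k) x))\<^sup>2) \<partial>M)"
      by (rule nn_integral_liminf) measurable
    also have "\<dots> \<le> liminf (\<lambda>k. ennreal (vol * B))"
    proof (intro Liminf_mono always_eventually allI)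
      fix k
      have "(\<integral>\<^sup>+x. ennreal ((cmod (trig_poly c (F k) x))\<^sup>2) \<partial>M) = ennreal (\<integral>x. (cmod (trig_poly c (F k) x))\<^sup>2 \<partial>M)"
        using L2_spaceD(2)[OF trig_poly_L2[of c "F k"]] by (intro nn_integral_eq_integral) auto
      also have "\<dots> \<le> ennreal (vol * B)"
        using F[of k] bound[of "F k"] by (intro ennreal_leI) (simp add: integral_norm_trig_poly mult_left_mono)
      finally show "(\<integral>\<^sup>+x. ennreal ((cmod (trig_poly c (F k) x))\<^sup>2) \<partial>M) \<le> ennreal (vol * B)" .
    qed
    also have "\<dots> = ennreal (vol * B)" by (simp add: Liminf_const)
    finally show ?thesis .
  qed
  have g_sq: "integrable M (\<lambda>x. (cmod (g x))\<^sup>2)"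
    by (rule integrableI_bounded) (use Fatou in \<open>auto intro: le_less_trans\<close>)
  have B: "0 \<le> B" using bound[of "{}"] by simp
  show ?thesis
  proof (rule that)
    show "g \<in> L2_space \<Omega>" using g_sq by (simp add: L2_space_def)
    have "ennreal (\<integral>x. (cmod (g x))\<^sup>2 \<partial>M) \<le> ennreal (vol * B)"
      using Fatou nn_integral_eq_integral[OF g_sq] by simp
    then show "(\<integral>x. (cmod (g x))\<^sup>2 \<partial>M) \<le> vol * B"
      using B by (subst (asm) ennreal_le_iff) auto
    fix \<kappa> assume \<kappa>: "\<kappa> \<in> D"
    \<comment> \<open>The coefficient at \<kappa> of the k-th partial sum. Its limit is found twice:
      from the integrals of the blocks, and from \<open>c\<close> directly.\<close>
    let ?d = "\<lambda>k. if \<kappa> \<in> F k then c \<kappa> else 0"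
    have "(\<lambda>k. \<integral>x. u k x * cnj (chr \<kappa> x) \<partial>M) sums (\<integral>x. (\<Sum>k. u k x * cnj (chr \<kappa> x)) \<partial>M)"
      using AE_summ summ by (intro sums_integral integrable_mult_chr u_int) (auto simp: norm_mult)
    also have "(\<integral>x. (\<Sum>k. u k x * cnj (chr \<kappa> x)) \<partial>M) = (\<integral>x. (\<Sum>k. u k x) * cnj (chr \<kappa> x) \<partial>M)"
    proof (rule integral_cong_AE)
      show "AE x in M. (\<Sum>k. u k x * cnj (chr \<kappa> x)) = (\<Sum>k. u k x) * cnj (chr \<kappa> x)"
        using AE_summ by eventually_elim (rule suminf_mult2[symmetric], erule summable_norm_cancel)
    qed measurable
    also have "(\<integral>x. (\<Sum>k. u k x) * cnj (chr \<kappa> x) \<partial>M) = (\<integral>x. (g x - trig_poly c (F 0) x) * cnj (chr \<kappa> x) \<partial>M)"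
      by (simp add: g_def)
    also have "\<dots> = of_real vol * (fourier_coeff \<Omega> g \<kappa> - ?d 0)"
      using fourier_coeff_trig_poly[of "F 0" \<kappa> c] F[of 0] \<kappa> L2_integrable[OF trig_poly_L2[of c "F 0"]] g_int
      by (simp add: integral_mult_cnj_chr[of "\<lambda>x. g x - trig_poly c (F 0) x"] fourier_coeff_diff)
    finally have "(\<lambda>k. \<Sum>j<k. \<integral>x. u j x * cnj (chr \<kappa> x) \<partial>M) \<longlonglongrightarrow> of_real vol * (fourier_coeff \<Omega> g \<kappa> - ?d 0)"
      by (simp add: sums_def)
    also have "(\<lambda>k. \<Sum>j<k. \<integral>x. u j x * cnj (chr \<kappa> x) \<partial>M) = (\<lambda>k. of_real vol * (?d k - ?d 0))"
    proof
      fix k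
      have "(\<Sum>j<k. \<integral>x. u j x * cnj (chr \<kappa> x) \<partial>M) = (\<integral>x. (\<Sum>j<k. u j x) * cnj (chr \<kappa> x) \<partial>M)"
        unfolding sum_distrib_right by (rule Bochner_Integration.integral_sum[symmetric]) (rule integrable_mult_chr[OF u_int])
      also have "\<dots> = (\<integral>x. (trig_poly c (F k) x - trig_poly c (F 0) x) * cnj (chr \<kappa> x) \<partial>M)"
        by (simp only: u_sum)
      also have "\<dots> = of_real vol * (?d k - ?d 0)"
        using fourier_coeff_trig_poly[of "F 0" \<kappa> c] fourier_coeff_trig_poly[of "F k" \<kappa> c] F[of 0] F[of k] \<kappa>
          L2_integrable[OF trig_poly_L2[of c "F 0"]] L2_integrable[OF trig_poly_L2[of c "F k"]]
        by (simp add: integral_mult_cnj_chr[of "\<lambda>x. trig_poly c (F k) x - trig_poly c (F 0) x"] fourier_coeff_diff)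
      finally show "(\<Sum>j<k. \<integral>x. u j x * cnj (chr \<kappa> x) \<partial>M) = of_real vol * (?d k - ?d 0)" .
    qed
    finally have lim1: "(\<lambda>k. of_real vol * (?d k - ?d 0)) \<longlonglongrightarrow> of_real vol * (fourier_coeff \<Omega> g \<kappa> - ?d 0)" .
    have d: "?d \<longlonglongrightarrow> c \<kappa>"
    proof (rule Lim_transform)
      show "(\<lambda>k. c \<kappa>) \<longlonglongrightarrow> c \<kappa>" by simp
      \<comment> \<open>As long as \<open>F k\<close> misses \<kappa>, the singleton of \<kappa>
        obeys the tail estimate; a frequency that is never caught therefore has coefficient
        0.\<close>
      have "norm (?d k - c \<kappa>) \<le> (1/2)^k" for k
      proof (cases "\<kappa> \<in> F k")
        case False
        then have "(cmod (c \<kappa>))\<^sup>2 \<le> (1/4)^k" using tail[of "{\<kappa>}" k] \<kappa> by (simp add: E_def)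
        also have "\<dots> = ((1/2)^k)\<^sup>2" by (simp add: power2_eq_square flip: power_mult_distrib)
        finally have "cmod (c \<kappa>) \<le> (1/2)^k" by (rule power2_le_imp_le) simp
        then show ?thesis using False by simp
      qed simp
      then show "(\<lambda>k. ?d k - c \<kappa>) \<longlonglongrightarrow> 0"
        by (intro Lim_null_comparison[OF _ LIMSEQ_power_zero[of "1/2 :: real"]]) auto
    qed
    have "(\<lambda>k. of_real vol * (?d k - ?d 0)) \<longlonglongrightarrow> of_real vol * (c \<kappa> - ?d 0)"
      by (intro tendsto_intros d)
    from LIMSEQ_unique[OF lim1 this] show "fourier_coeff \<Omega> g \<kappa> = c \<kappa>"
      using measure_dom_pos by simp
  qed
qed

end

section \<open>Completeness of the characters\<close>

lemma chr_diff: "chr \<kappa> (x - y) = chr \<kappa> x / chr \<kappa> y"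
  by (simp add: chr_def cis_divide inner_diff_right algebra_simps)

text \<open>The base case of polynomial functions is an arbitrary bounded real-linear map, which is
  determined by its values on the real basis \<open>axis i 1\<close>,
  \<open>axis i \<i>\<close>.\<close>

lemma real_linear_vec_complex:
  fixes p :: "complex^'n \<Rightarrow> real"
  assumes "bounded_linear p"
  shows "p z = (\<Sum>i\<in>UNIV. Re (z $ i) * p (axis i 1) + Im (z $ i) * p (axis i \<i>))"
proof -
  interpret bounded_linear p by fact
  have "z = (\<Sum>i\<in>UNIV. Re (z $ i) *\<^sub>R axis i 1 + Im (z $ i) *\<^sub>R axis i \<i>)"
    by (simp add: vec_eq_iff axis_def if_distrib[of "scaleR _"] sum.distrib complex_eq_iff cong: if_cong)
  then have "p z = p (\<Sum>i\<in>UNIV. Re (z $ i) *\<^sub>R axis i 1 + Im (z $ i) *\<^sub>R axis i \<i>)" by simp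
  then show ?thesis by (simp add: sum add scaleR)
qed

text \<open>Modulo the lattice this embeds the torus into a Euclidean space, where polynomial
  approximation and distance functions are available.\<close>

definition torus_map :: "real^'n^'n \<Rightarrow> real^'n \<Rightarrow> complex^'n"
  where "torus_map A x = (\<chi> i. chr (dual_basis A i) x)"

lemma continuous_on_torus_map: "continuous_on S (torus_map A)"
  unfolding torus_map_def[abs_def] by (intro continuous_on_vec_lambda continuous_intros)

text \<open>A crude bound that provides the compact ball for polynomial approximation.\<close>

lemma norm_torus_map_le: "norm (torus_map (A :: real^'n^'n) x) \<le> CARD('n)"
  using L2_set_le_sum[of UNIV "\<lambda>i. norm (torus_map A x $ i)"]
  by (simp add: norm_vec_def torus_map_def)

lemma torus_map_eqD:
  assumes "invertible A" "torus_map A x = torus_map A y"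
  shows "x - y \<in> lattice A"
proof (rule dual_basis_detects_lattice[OF assms(1)])
  fix i
  have "chr (dual_basis A i) x = chr (dual_basis A i) y"
    using assms(2) by (simp add: torus_map_def vec_eq_iff)
  moreover have "chr (dual_basis A i) y \<noteq> 0"
    by (metis norm_chr norm_zero zero_neq_one)
  ultimately have "chr (dual_basis A i) (x - y) = 1" by (simp add: chr_diff)
  then show "dual_basis A i \<bullet> (x - y) \<in> \<int>" by (simp add: chr_eq_1_iff)
qed

section \<open>The annihilator of the characters\<close>

context lattice_domain
begin

text \<open>The annihilator taken inside L1, which pairs well with the bounded test functions used
  below.\<close>

definition null_coeffs :: "(real^'n \<Rightarrow> complex) \<Rightarrow> bool"
  where "null_coeffs u \<longleftrightarrow> integrable M u \<and> (\<forall>\<kappa>\<in>D. (\<integral>x. u x * cnj (chr \<kappa> x) \<partial>M) = 0)"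

text \<open>Passing to multipliers of the annihilator makes closure under products immediate.\<close>
definition null_multiplier :: "(real^'n \<Rightarrow> complex) \<Rightarrow> bool"
  where "null_multiplier t \<longleftrightarrow> (\<forall>u. null_coeffs u \<longrightarrow> null_coeffs (\<lambda>x. u x * t x))"

lemma null_multiplier_mult:
  "null_multiplier s \<Longrightarrow> null_multiplier t \<Longrightarrow> null_multiplier (\<lambda>x. s x * t x)"
  unfolding null_multiplier_def by (simp flip: mult.assoc)

lemma null_multiplier_add:
  assumes "null_multiplier s" "null_multiplier t"
  shows "null_multiplier (\<lambda>x. s x + t x)"
  unfolding null_multiplier_def
proof (intro allI impI)
  fix u assume "null_coeffs u"
  with assms have "null_coeffs (\<lambda>x. u x * s x)" "null_coeffs (\<lambda>x. u x * t x)"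
    by (auto simp: null_multiplier_def)
  then have I: "integrable M (\<lambda>x. u x * s x)" "integrable M (\<lambda>x. u x * t x)"
    and Z: "\<And>\<kappa>. \<kappa> \<in> D \<Longrightarrow> (\<integral>x. u x * s x * cnj (chr \<kappa> x) \<partial>M) = 0"
      "\<And>\<kappa>. \<kappa> \<in> D \<Longrightarrow> (\<integral>x. u x * t x * cnj (chr \<kappa> x) \<partial>M) = 0"
    by (auto simp: null_coeffs_def)
  show "null_coeffs (\<lambda>x. u x * (s x + t x))"
    unfolding null_coeffs_def distrib_left distrib_right
    by (simp add: Bochner_Integration.integral_add[OF I[THEN integrable_mult_chr]] Z I)
qed

lemma null_multiplier_const: "null_multiplier (\<lambda>x. c)"
  unfolding null_multiplier_def null_coeffs_def by (auto simp: mult.assoc mult.left_commute[of _ c])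

lemma null_multiplier_sum:
  "finite I \<Longrightarrow> (\<And>i. i \<in> I \<Longrightarrow> null_multiplier (t i)) \<Longrightarrow> null_multiplier (\<lambda>x. \<Sum>i\<in>I. t i x)"
  by (induction I rule: finite_induct) (auto intro: null_multiplier_add null_multiplier_const[of 0])

text \<open>Multiplication by a character only translates the frequencies, and the dual lattice is
  closed under differences.\<close>

lemma null_multiplier_chr:
  assumes "\<kappa> \<in> D"
  shows "null_multiplier (chr \<kappa>)"
  unfolding null_multiplier_def null_coeffs_def
proof (intro allI impI ballI conjI; elim conjE)
  fix u assume u: "integrable M u" "\<forall>\<kappa>\<in>D. (\<integral>x. u x * cnj (chr \<kappa> x) \<partial>M) = 0"
  show "integrable M (\<lambda>x. u x * chr \<kappa> x)"
    using integrable_mult_chr[OF u(1), of "- \<kappa>"] by (simp add: cnj_chr)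
  fix \<mu> assume "\<mu> \<in> D"
  then have "(\<integral>x. u x * cnj (chr (\<mu> - \<kappa>) x) \<partial>M) = 0"
    using u(2) assms dual_lattice_diff by blast
  then show "(\<integral>x. u x * chr \<kappa> x * cnj (chr \<mu> x) \<partial>M) = 0"
    by (simp add: cnj_chr mult.assoc flip: chr_add_left)
qed

lemma null_multiplier_polynomial:
  assumes "real_polynomial_function p"
  shows "null_multiplier (\<lambda>x. of_real (p (torus_map A x)))"
  using assms
proof induction
  case (linear p)
  let ?b = "dual_basis A"
  \<comment> \<open>This is a Re z + b Im z = (a - \<i> b)/2 z + (a + \<i> b)/2 cnj z in each
    coordinate; conjugating a character negates its frequency.\<close>
  have "of_real (p (torus_map A x)) = (\<Sum>i\<in>UNIV.
      (of_real (p (axis i 1)) - \<i> * of_real (p (axis i \<i>))) / 2 * chr (?b i) x +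
      (of_real (p (axis i 1)) + \<i> * of_real (p (axis i \<i>))) / 2 * chr (- ?b i) x)" for x
    unfolding real_linear_vec_complex[OF linear, of "torus_map A x"] of_real_sum
    by (intro sum.cong refl) (simp add: torus_map_def complex_eq_iff field_simps flip: cnj_chr)
  moreover have "- ?b i \<in> D" for i
    using dual_lattice_diff[OF _ dual_basis_in[of A i], of 0] by (simp add: dual_lattice_def)
  ultimately show ?case
    by (simp only:) (intro null_multiplier_sum null_multiplier_add null_multiplier_mult
        null_multiplier_const null_multiplier_chr dual_basis_in; simp)
next
  case (const c)
  then show ?case by (rule null_multiplier_const)
next
  case (add p q)
  then show ?case by (simp add: null_multiplier_add)
next
  case (mult p q)
  then show ?case by (simp add: null_multiplier_mult)
qed

lemma integral_polynomial_eq_0: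
  assumes "null_coeffs u" "real_polynomial_function p"
  shows "integrable M (\<lambda>x. u x * of_real (p (torus_map A x)))"
    "(\<integral>x. u x * of_real (p (torus_map A x)) \<partial>M) = 0"
proof -
  have "null_coeffs (\<lambda>x. u x * of_real (p (torus_map A x)))"
    using null_multiplier_polynomial[OF assms(2)] assms(1) by (simp add: null_multiplier_def)
  moreover have "0 \<in> D" by (simp add: dual_lattice_def)
  ultimately show "integrable M (\<lambda>x. u x * of_real (p (torus_map A x)))"
    "(\<integral>x. u x * of_real (p (torus_map A x)) \<partial>M) = 0"
    by (auto simp: null_coeffs_def dest: bspec[of _ _ 0])
qed

lemma measurable_torus_compose:
  fixes \<phi> :: "complex^'n \<Rightarrow> real"
  assumes "continuous_on UNIV \<phi>"
  shows "(\<lambda>x. \<phi> (torus_map A x)) \<in> borel_measurable M"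
proof -
  have "continuous_on UNIV (\<lambda>x. \<phi> (torus_map A x))"
    using continuous_on_compose2[OF assms continuous_on_torus_map] by auto
  then have "(\<lambda>x. \<phi> (torus_map A x)) \<in> borel_measurable lebesgue"
    by (simp add: borel_measurable_continuous_onI measurable_completion)
  then show ?thesis by (rule measurable_restrict_space1)
qed

text \<open>A polynomial within e of \<phi> on a ball containing the image of the torus map changes
  the integral by at most e times the L1 norm of u.\<close>

lemma integral_continuous_eq_0:
  fixes \<phi> :: "complex^'n \<Rightarrow> real"
  assumes u: "null_coeffs u" and \<phi>: "continuous_on UNIV \<phi>" and bd: "\<And>z. \<bar>\<phi> z\<bar> \<le> 1"
  shows "(\<integral>x. u x * of_real (\<phi> (torus_map A x)) \<partial>M) = 0"
proof -
  let ?K = "cball 0 (real CARD('n)) :: (complex^'n) set"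
  have u_int: "integrable M u" using u by (simp add: null_coeffs_def)
  note [measurable] = borel_measurable_integrable[OF u_int] measurable_torus_compose[OF \<phi>]
  have int: "integrable M (\<lambda>x. u x * of_real (\<phi> (torus_map A x)))"
    by (rule Bochner_Integration.integrable_bound[OF u_int]) (auto simp: norm_mult intro!: mult_left_le bd)
  have bound: "norm (\<integral>x. u x * of_real (\<phi> (torus_map A x)) \<partial>M) \<le> e * (\<integral>x. norm (u x) \<partial>M)" if e: "e > 0" for e
  proof -
    obtain p where p: "real_polynomial_function p" "\<And>z. z \<in> ?K \<Longrightarrow> \<bar>\<phi> z - p z\<bar> < e"
      using Stone_Weierstrass_real_polynomial_function[OF compact_cball continuous_on_subset[OF \<phi> subset_UNIV] e] by metis
    note P = integral_polynomial_eq_0[OF u p(1)]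
    have "(\<integral>x. u x * of_real (\<phi> (torus_map A x)) \<partial>M) =
        (\<integral>x. u x * of_real (\<phi> (torus_map A x)) - u x * of_real (p (torus_map A x)) \<partial>M)"
      using Bochner_Integration.integral_diff[OF int P(1)] P(2) by simp
    also have "norm \<dots> \<le> (\<integral>x. e * norm (u x) \<partial>M)"
    proof (rule order.trans[OF Bochner_Integration.integral_norm_bound], rule Bochner_Integration.integral_mono)
      show "integrable M (\<lambda>x. norm (u x * of_real (\<phi> (torus_map A x)) - u x * of_real (p (torus_map A x))))"
        by (rule integrable_norm[OF Bochner_Integration.integrable_diff[OF int P(1)]])
      show "integrable M (\<lambda>x. e * norm (u x))" using u_int by simp
      fix x
      have "\<bar>\<phi> (torus_map A x) - p (torus_map A x)\<bar> \<le> e"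
        using p(2)[of "torus_map A x"] norm_torus_map_le[of A x] by simp
      moreover have "norm (u x * of_real (\<phi> (torus_map A x)) - u x * of_real (p (torus_map A x))) =
          norm (u x) * \<bar>\<phi> (torus_map A x) - p (torus_map A x)\<bar>"
        by (simp add: norm_mult flip: right_diff_distrib of_real_diff)
      ultimately show "norm (u x * of_real (\<phi> (torus_map A x)) - u x * of_real (p (torus_map A x))) \<le> e * norm (u x)"
        by (simp add: mult.commute[of e] mult_left_mono)
    qed
    finally show ?thesis by simp
  qed
  let ?a = "norm (\<integral>x. u x * of_real (\<phi> (torus_map A x)) \<partial>M)" and ?I = "\<integral>x. norm (u x) \<partial>M"
  have "?a \<le> 0 + d" if "d > 0" for d
  proof -
    have I: "?I \<ge> 0" by simp
    \<comment> \<open>Dividing by J + 1 instead of J also covers a vanishing L1 norm.\<close>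
    have "d / (J + 1) * J \<le> d" if "J \<ge> 0" for J
      using that \<open>d > 0\<close> by (simp add: field_simps)
    note this[OF I]
    moreover have "?a \<le> d / (?I + 1) * ?I"
      using bound[of "d / (?I + 1)"] I that by simp
    ultimately show ?thesis by simp
  qed
  then have "?a \<le> 0" by (rule field_le_epsilon)
  then show ?thesis by simp
qed

text \<open>Tent functions around the closed set \<open>?F\<close> decrease to its indicator. Pulled
  back to \<Omega> this is the indicator of X, because the torus map is injective on
  \<Omega>.\<close>

lemma integral_compact_eq_0:
  assumes u: "null_coeffs u" and X: "compact X" "X \<subseteq> \<Omega>"
  shows "(\<integral>x. u x * indicator X x \<partial>M) = 0"
\<comment> \<open>The distance \<open>infdist\<close> to the empty set is 0, so the tents would be
  constantly 1 there.\<close>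
proof (cases "X = {}")
  case False
  let ?F = "torus_map A ` X"
  define \<phi> where "\<phi> k z = max 0 (1 - real k * infdist z ?F)" for k z
  have F: "closed ?F" "?F \<noteq> {}"
    using X False by (auto intro!: compact_imp_closed compact_continuous_image continuous_on_torus_map)
  have u_int: "integrable M u" using u by (simp add: null_coeffs_def)
  have \<phi>: "continuous_on UNIV (\<phi> k)" "\<bar>\<phi> k z\<bar> \<le> 1" for k z
    unfolding \<phi>_def[abs_def] by (intro continuous_intros) (auto simp: infdist_nonneg)
  note [measurable] = borel_measurable_integrable[OF u_int] measurable_torus_compose[OF \<phi>(1)]
  have "X \<in> sets lebesgue"
    using X(1) by (simp add: compact_imp_closed borel_closed sets_completionI_sets)
  then have [measurable]: "X \<in> sets M"
    using X(2) by (auto simp: sets_restrict_space)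
  have "(\<lambda>k. \<integral>x. u x * of_real (\<phi> k (torus_map A x)) \<partial>M) \<longlonglongrightarrow> (\<integral>x. u x * indicator X x \<partial>M)"
  proof (rule integral_dominated_convergence[where w = "\<lambda>x. norm (u x)"])
    show "integrable M (\<lambda>x. norm (u x))" using u_int by simp
    show "AE x in M. norm (u x * of_real (\<phi> k (torus_map A x))) \<le> norm (u x)" for k
      by (auto simp: norm_mult intro!: mult_left_le \<phi>)
    have "(\<lambda>k. \<phi> k (torus_map A x)) \<longlonglongrightarrow> indicator X x" if "x \<in> \<Omega>" for x
    proof (cases "x \<in> X")
      case True
      then show ?thesis by (simp add: \<phi>_def)
    next
      case False
      have "torus_map A x \<notin> ?F"
      proof
        assume "torus_map A x \<in> ?F"
        then obtain y where y: "y \<in> X" "torus_map A x = torus_map A y" by blast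
        then have "rep x = y" using X(2) torus_map_eqD[OF inv] by (auto intro: rep_eqI)
        then show False using False y rep_ident[OF that] by simp
      qed
      then have pos: "infdist (torus_map A x) ?F > 0"
        using in_closed_iff_infdist_zero[OF F] infdist_nonneg[of "torus_map A x" ?F] by fastforce
      obtain m where m: "1 < real m * infdist (torus_map A x) ?F"
        using reals_Archimedean3[OF pos] by blast
      have "\<phi> k (torus_map A x) = 0" if "k \<ge> m" for k
        using m mult_right_mono[OF _ less_imp_le[OF pos], of "real m" "real k"] that by (simp add: \<phi>_def)
      then have "eventually (\<lambda>k. \<phi> k (torus_map A x) = 0) sequentially"
        using eventually_sequentially by blast
      then show ?thesis using False by (simp add: tendsto_eventually)
    qed
    then have "(\<lambda>k. u x * of_real (\<phi> k (torus_map A x))) \<longlonglongrightarrow> u x * of_real (indicator X x)" if "x \<in> \<Omega>" for x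
      using that by (intro tendsto_intros)
    then show "AE x in M. (\<lambda>k. u x * of_real (\<phi> k (torus_map A x))) \<longlonglongrightarrow> u x * indicator X x"
      by (intro AE_I2) (simp add: of_real_indicator)
  qed measurable
  then show ?thesis
    by (simp add: integral_continuous_eq_0[OF u \<phi>] LIMSEQ_const_iff)
qed simp

text \<open>On a compact subset of a level set r > 1 / (n + 1) a vanishing integral forces measure
  zero; inner regularity extends this to the whole level set.\<close>

lemma AE_nonpos_of_compact_integrals:
  fixes r :: "real^'n \<Rightarrow> real"
  assumes r: "integrable M r"
    and X0: "\<And>X. compact X \<Longrightarrow> X \<subseteq> \<Omega> \<Longrightarrow> (\<integral>x. r x * indicator X x \<partial>M) = 0"
  shows "AE x in M. r x \<le> 0"
proof -
  note [measurable] = borel_measurable_integrable[OF r]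
  define S where "S n = {x \<in> \<Omega>. r x > 1 / real (Suc n)}" for n
  have S_M: "S n \<in> sets M" for n
  proof -
    have "{x \<in> space M. r x > 1 / real (Suc n)} \<in> sets M" by measurable
    then show ?thesis by (simp add: S_def)
  qed
  then have S: "S n \<in> sets lebesgue" "S n \<subseteq> \<Omega>" for n
    using S_M[of n] by (simp_all add: sets_restrict_space_iff)
  have null: "S n \<in> null_sets lebesgue" for n
  proof -
    have compact_null: "X \<in> null_sets lebesgue" if X: "compact X" "X \<subseteq> S n" for X
    proof -
      have Xl: "X \<in> lmeasurable" using X(1) by (rule lmeasurable_compact)
      have XO: "X \<subseteq> \<Omega>" using X(2) S(2) by blast
      then have [measurable]: "X \<in> sets M" using Xl by (auto simp: sets_restrict_space fmeasurable_def)
      have mX: "measure M X = measure lebesgue X" using XO Xl by (simp add: measure_restrict_space)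
      have "1 / real (Suc n) * measure lebesgue X = (\<integral>x. 1 / real (Suc n) * indicator X x \<partial>M)"
        using XO by (simp add: mX inf.absorb1)
      also have "\<dots> \<le> (\<integral>x. r x * indicator X x \<partial>M)"
      proof (rule Bochner_Integration.integral_mono)
        show "integrable M (\<lambda>x. 1 / real (Suc n) * indicator X x)"
          by (intro integrable_mult_right integrable_real_indicator) (auto simp: emeasure_eq_measure)
        show "integrable M (\<lambda>x. r x * indicator X x)"
          by (rule integrable_real_mult_indicator[OF _ r]) simp
        fix x
        show "1 / real (Suc n) * indicator X x \<le> r x * indicator X x"
          using X(2) by (auto simp: indicator_def S_def)
      qed
      also have "\<dots> = 0" by (rule X0[OF X(1) XO])
      finally have "measure lebesgue X \<le> 0" by (simp add: field_simps del: of_nat_Suc)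
      then have "measure lebesgue X = 0" by (simp add: measure_le_0_iff)
      then show ?thesis
        by (intro null_setsI fmeasurableD[OF Xl]) (simp only: emeasure_eq_measure2[OF Xl] ennreal_0)
    qed
    have le: "emeasure lebesgue (S n) \<le> 0 + ennreal e" if e: "e > 0" for e
    proof -
      obtain T where T: "closed T" "T \<subseteq> S n" "S n - T \<in> lmeasurable" "emeasure lebesgue (S n - T) < ennreal e"
        using sets_lebesgue_inner_closed[OF S(1)[of n] e] by metis
      \<comment> \<open>The inner approximation \<open>T\<close> is closed but perhaps unbounded;
        balls exhaust it by compact sets.\<close>
      have "(\<Union>m. T \<inter> cball 0 (real m)) \<in> null_sets lebesgue"
        using T(1,2) by (intro null_sets_UN compact_null) (auto intro: closed_Int_compact)
      moreover have "(\<Union>m. T \<inter> cball 0 (real m)) = T"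
        using real_arch_simple by (auto simp: dist_norm)
      ultimately have T0: "T \<in> null_sets lebesgue" by simp
      have "emeasure lebesgue (S n) \<le> emeasure lebesgue (T \<union> (S n - T))"
        using T S(1)[of n] T0 by (intro emeasure_mono) auto
      also have "\<dots> \<le> emeasure lebesgue T + emeasure lebesgue (S n - T)"
        using T T0 by (intro emeasure_subadditive) (auto simp: fmeasurable_def)
      also have "\<dots> \<le> 0 + ennreal e" using T(4) null_setsD1[OF T0] by (simp del: emeasure_completion)
      finally show ?thesis .
    qed
    have "emeasure lebesgue (S n) \<le> 0" by (rule ennreal_le_epsilon) (rule le)
    then show ?thesis by (intro null_setsI S(1)) (rule le_zero_eq[THEN iffD1])
  qed
  then have "S n \<in> null_sets M" for n
    using S(2)[of n] S_M[of n] by (auto simp: null_sets_def emeasure_restrict_space)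
  then have N: "(\<Union>n. S n) \<in> null_sets M" by (rule null_sets_UN)
  show ?thesis
  proof (rule AE_I'[OF N], safe)
    fix x assume x: "x \<in> space M" "\<not> r x \<le> 0"
    then obtain n where "inverse (real (Suc n)) < r x" using reals_Archimedean[of "r x"] by auto
    then show "x \<in> (\<Union>n. S n)" using x by (auto simp: S_def inverse_eq_divide)
  qed
qed

lemma null_coeffs_AE_0:
  assumes "null_coeffs u"
  shows "AE x in M. u x = 0"
proof -
  have u: "integrable M u" using assms by (simp add: null_coeffs_def)
  have uX: "integrable M (\<lambda>x. u x * indicator X x)" if "compact X" "X \<subseteq> \<Omega>" for X
  proof -
    have "X \<in> sets M"
      using lmeasurable_compact[OF that(1)] that(2) by (auto simp: sets_restrict_space fmeasurable_def)
    then show ?thesis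
      using integrable_mult_indicator[OF _ u, of X] by (simp add: scaleR_conv_of_real of_real_indicator mult.commute)
  qed
  have Re0: "(\<integral>x. Re (u x) * indicator X x \<partial>M) = 0" and Im0: "(\<integral>x. Im (u x) * indicator X x \<partial>M) = 0"
    if "compact X" "X \<subseteq> \<Omega>" for X
  proof -
    have "Re (u x * indicator X x) = Re (u x) * indicator X x" "Im (u x * indicator X x) = Im (u x) * indicator X x" for x
      by (auto simp: indicator_def)
    then show "(\<integral>x. Re (u x) * indicator X x \<partial>M) = 0" "(\<integral>x. Im (u x) * indicator X x \<partial>M) = 0"
      using integral_Re[OF uX[OF that]] integral_Im[OF uX[OF that]] integral_compact_eq_0[OF assms that] by simp_all
  qed
  \<comment> \<open>The one-sided real statement for both signs of both parts gives u = 0.\<close>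
  have "AE x in M. Re (u x) \<le> 0" "AE x in M. - Re (u x) \<le> 0" "AE x in M. Im (u x) \<le> 0" "AE x in M. - Im (u x) \<le> 0"
    by (rule AE_nonpos_of_compact_integrals; use u Re0 Im0 in simp)+
  then show ?thesis
    by eventually_elim (simp add: complex_eq_iff)
qed

text \<open>Riesz-Fischer gives a function with the coefficients of f and squared norm at most
  \<open>vol * B\<close>; the difference to f lies in the annihilator.\<close>

lemma parseval_le:
  assumes f: "f \<in> L2_space \<Omega>"
    and bound: "\<And>F. finite F \<Longrightarrow> F \<subseteq> D \<Longrightarrow> (\<Sum>\<kappa>\<in>F. (cmod (fourier_coeff \<Omega> f \<kappa>))\<^sup>2) \<le> B"
  shows "(\<integral>x. (cmod (f x))\<^sup>2 \<partial>M) \<le> vol * B"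
proof -
  obtain g where g: "g \<in> L2_space \<Omega>" "\<And>\<kappa>. \<kappa> \<in> D \<Longrightarrow> fourier_coeff \<Omega> g \<kappa> = fourier_coeff \<Omega> f \<kappa>"
    "(\<integral>x. (cmod (g x))\<^sup>2 \<partial>M) \<le> vol * B"
    using riesz_fischer[OF bound] by metis
  have "null_coeffs (\<lambda>x. f x - g x)"
    unfolding null_coeffs_def integral_mult_cnj_chr
    using f g(1,2) by (auto simp: L2_integrable fourier_coeff_diff)
  then have AE: "AE x in M. f x - g x = 0" by (rule null_coeffs_AE_0)
  have "(\<integral>x. (cmod (f x))\<^sup>2 \<partial>M) = (\<integral>x. (cmod (g x))\<^sup>2 \<partial>M)"
    by (rule integral_cong_AE) (use f g AE in \<open>auto dest: L2_spaceD\<close>)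
  then show ?thesis using g(3) by simp
qed

end

section \<open>Fourier characterisation of the Lipschitz classes\<close>

lemma norm_chr_minus_1: "norm (chr \<kappa> h - 1) = 2 * \<bar>sin (pi * (\<kappa> \<bullet> h))\<bar>"
proof -
  have "(norm (chr \<kappa> h - 1))\<^sup>2 = (2 * \<bar>sin (pi * (\<kappa> \<bullet> h))\<bar>)\<^sup>2"
    using cos_double_sin[of "pi * (\<kappa> \<bullet> h)"] sin_cos_squared_add[of "2 * pi * (\<kappa> \<bullet> h)"]
    by (simp add: cmod_power2 chr_def power2_diff power_mult_distrib mult.assoc)
  then show ?thesis by (rule power2_eq_imp_eq) auto
qed

lemma norm_chr_minus_1_le: "norm (chr \<kappa> h - 1) \<le> 2 * pi * norm \<kappa> * norm h"
proof -
  have "\<bar>sin (pi * (\<kappa> \<bullet> h))\<bar> \<le> \<bar>pi * (\<kappa> \<bullet> h)\<bar>" by (rule abs_sin_x_le_abs_x)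
  also have "\<dots> \<le> pi * (norm \<kappa> * norm h)"
    by (simp add: abs_mult Cauchy_Schwarz_ineq2)
  finally show ?thesis by (simp add: norm_chr_minus_1)
qed

text \<open>Jordan's inequality: the concave sine lies above its chord on [0, pi/2].\<close>

lemma sin_ge_linear:
  assumes "0 \<le> u" "u \<le> 1/2"
  shows "sin (pi * u) \<ge> 2 * u"
proof -
  have "concave_on {0..pi/2} sin"
    by (rule f''_le0_imp_concave[where f' = cos and f'' = "\<lambda>x. - sin x"])
      (auto intro!: derivative_eq_intros sin_ge_zero)
  from concave_onD[OF this, of "2 * u" 0 "pi / 2"] show ?thesis
    using assms by (simp add: mult_ac)
qed

lemma norm_chr_minus_1_ge:
  assumes "\<bar>\<kappa> \<bullet> h\<bar> \<le> 1/2"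
  shows "norm (chr \<kappa> h - 1) \<ge> 4 * \<bar>\<kappa> \<bullet> h\<bar>"
proof -
  have "2 * \<bar>u\<bar> \<le> \<bar>sin (pi * u)\<bar>" if "\<bar>u\<bar> \<le> 1/2" for u
    using sin_ge_linear[of "\<bar>u\<bar>"] that by (cases "u \<ge> 0") auto
  from this[OF assms] show ?thesis
    by (simp add: norm_chr_minus_1)
qed

text \<open>The constant \<open>K = a / (1 - q)\<close> is the fixed point of the dyadic recursion \<open>K = a + q K\<close>.\<close>
lemma dyadic_tail_bound:
  fixes w :: "'a :: real_normed_vector \<Rightarrow> real"
  assumes \<alpha>: "\<alpha> > 0" and R0: "R0 > 0"
    and shell: "\<And>R F. R \<ge> R0 \<Longrightarrow> finite F \<Longrightarrow> F \<subseteq> E \<Longrightarrow> (\<And>\<kappa>. \<kappa> \<in> F \<Longrightarrow> R < norm \<kappa> \<and> norm \<kappa> \<le> 2 * R)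
        \<Longrightarrow> sum w F \<le> a * R powr (- 2 * \<alpha>)"
    and F: "R \<ge> R0" "finite F" "F \<subseteq> E" "\<And>\<kappa>. \<kappa> \<in> F \<Longrightarrow> R < norm \<kappa>"
  shows "sum w F \<le> a / (1 - 2 powr (- 2 * \<alpha>)) * R powr (- 2 * \<alpha>)"
proof -
  define q where "q = (2::real) powr (- 2 * \<alpha>)"
  have q: "0 < q" "q < 1"
    using \<alpha> powr_less_mono[of "- 2 * \<alpha>" 0 "2::real"] by (auto simp: q_def)
  have a: "a \<ge> 0"
    using shell[of R0 "{}"] R0 by (simp add: zero_le_mult_iff)
  define K where "K = a / (1 - q)"
  have K: "a + K * q = K" "K \<ge> 0" using q a by (auto simp: K_def field_simps)
  \<comment> \<open>The auxiliary \<open>m\<close> bounds the frequencies from above and drives the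
    induction, while \<open>K\<close> does not depend on it.\<close>
  have "sum w F \<le> K * R powr (- 2 * \<alpha>)"
    if "R \<ge> R0" "finite F" "F \<subseteq> E" "\<And>\<kappa>. \<kappa> \<in> F \<Longrightarrow> R < norm \<kappa> \<and> norm \<kappa> \<le> 2 ^ m * R" for m R F
    using that
  proof (induction m arbitrary: R F)
    case 0
    then have "F = {}" by fastforce
    then show ?case using K by simp
  next
    case (Suc m)
    let ?G = "{\<kappa> \<in> F. norm \<kappa> \<le> 2 * R}" and ?H = "{\<kappa> \<in> F. \<not> norm \<kappa> \<le> 2 * R}"
    have "sum w F = sum w ?G + sum w ?H"
      using Suc.prems(2) by (subst sum.union_disjoint[symmetric]) (auto intro: arg_cong[of _ _ "sum w"])
    also have "sum w ?G \<le> a * R powr (- 2 * \<alpha>)"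
      using Suc.prems by (intro shell) auto
    also have "sum w ?H \<le> K * (2 * R) powr (- 2 * \<alpha>)"
      using Suc.prems R0 by (intro Suc.IH) (auto simp: mult_ac)
    also have "(2 * R) powr (- 2 * \<alpha>) = q * R powr (- 2 * \<alpha>)"
      using Suc.prems(1) R0 by (simp add: q_def powr_mult)
    also have "a * R powr (- 2 * \<alpha>) + K * (q * R powr (- 2 * \<alpha>)) = K * R powr (- 2 * \<alpha>)"
      by (subst (2) K(1)[symmetric]) (simp add: algebra_simps)
    finally show ?case by simp
  qed
  moreover obtain m where "\<And>\<kappa>. \<kappa> \<in> F \<Longrightarrow> norm \<kappa> \<le> 2 ^ m * R"
  proof -
    obtain B where B: "\<And>\<kappa>. \<kappa> \<in> F \<Longrightarrow> norm \<kappa> \<le> B"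
      using finite_imp_bounded[OF F(2)] by (auto simp: bounded_iff)
    obtain m where "B / R < 2 ^ m" using real_arch_pow[of 2 "B / R"] by auto
    then have "B \<le> 2 ^ m * R" using F(1) R0 by (simp add: pos_divide_less_eq)
    then show ?thesis using B that order.trans by blast
  qed
  ultimately show ?thesis using F unfolding K_def q_def by blast
qed

text \<open>The shell below R contributes at most a multiple of R^2 R^(-2 \<beta>). As \<beta> < 1
  this grows geometrically from shell to shell, so the outermost one dominates; the ball of radius 2
  is charged to \<open>4 * G\<close>.\<close>

lemma dyadic_moment_bound:
  fixes w :: "'a :: real_normed_vector \<Rightarrow> real"
  assumes \<beta>: "\<beta> < 1" and w: "\<And>\<kappa>. w \<kappa> \<ge> 0" and K: "K \<ge> 0"
    and total: "\<And>F. finite F \<Longrightarrow> F \<subseteq> E \<Longrightarrow> sum w F \<le> G"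
    and tail: "\<And>R F. R \<ge> 1 \<Longrightarrow> finite F \<Longrightarrow> F \<subseteq> E \<Longrightarrow> (\<And>\<kappa>. \<kappa> \<in> F \<Longrightarrow> R < norm \<kappa>)
      \<Longrightarrow> sum w F \<le> K * R powr (- 2 * \<beta>)"
  obtains K' where "K' \<ge> 0" "\<And>R F. R \<ge> 1 \<Longrightarrow> finite F \<Longrightarrow> F \<subseteq> E \<Longrightarrow> (\<And>\<kappa>. \<kappa> \<in> F \<Longrightarrow> norm \<kappa> \<le> R)
    \<Longrightarrow> (\<Sum>\<kappa>\<in>F. (norm \<kappa>)\<^sup>2 * w \<kappa>) \<le> 4 * G + K' * R powr (2 - 2 * \<beta>)"
proof -
  define p where "p = (2::real) powr (2 - 2 * \<beta>)"
  have p: "p > 1" using \<beta> powr_less_mono[of 0 "2 - 2 * \<beta>" "2::real"] by (simp add: p_def)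
  \<comment> \<open>Constant of one shell: its tail starts at R/2, and (R/2)^(-2 \<beta>) = 2^(2
    \<beta>) R^(-2 \<beta>).\<close>
  define b where "b = K * 2 powr (2 * \<beta>)"
  have b: "b \<ge> 0" using K by (simp add: b_def)
  \<comment> \<open>Fixed point of K' = K' / p + b: halving R divides the power of R by
    \<open>p\<close>, and one shell adds \<open>b\<close>.\<close>
  define K' where "K' = b * p / (p - 1)"
  have K': "K' \<ge> 0" "K' / p + b = K'" using p b by (auto simp: K'_def field_simps)
  have crude: "(\<Sum>\<kappa>\<in>F. (norm \<kappa>)\<^sup>2 * w \<kappa>) \<le> R\<^sup>2 * sum w F" if "\<And>\<kappa>. \<kappa> \<in> F \<Longrightarrow> norm \<kappa> \<le> R" for R F
    unfolding sum_distrib_left using that w by (intro sum_mono mult_right_mono power_mono) auto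
  have G: "G \<ge> 0" using total[of "{}"] by simp
  have dyadic: "(\<Sum>\<kappa>\<in>F. (norm \<kappa>)\<^sup>2 * w \<kappa>) \<le> 4 * G + K' * R powr (2 - 2 * \<beta>)"
    \<comment> \<open>The exponent \<open>Suc m\<close> puts the base case at R \<le> 2, where the
      weights are at most 4.\<close>
    if "R \<ge> 1" "R \<le> 2 ^ Suc m" "finite F" "F \<subseteq> E" "\<And>\<kappa>. \<kappa> \<in> F \<Longrightarrow> norm \<kappa> \<le> R" for m R F
    using that
  proof (induction m arbitrary: R F)
    case 0
    have "(\<Sum>\<kappa>\<in>F. (norm \<kappa>)\<^sup>2 * w \<kappa>) \<le> 2\<^sup>2 * sum w F"
      using 0 by (intro crude) force
    also have "\<dots> \<le> 4 * G" using total[OF 0(3,4)] by simp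
    finally show ?case using K'(1) by (simp add: add_increasing2)
  next
    case (Suc m)
    show ?case
    \<comment> \<open>The recursion passes to R/2, which must be at least 1 for the induction
      hypothesis and for the tail hypothesis.\<close>
    proof (cases "R \<le> 2")
      case True
      have "(\<Sum>\<kappa>\<in>F. (norm \<kappa>)\<^sup>2 * w \<kappa>) \<le> 2\<^sup>2 * sum w F"
        using Suc.prems(5) True by (intro crude) force
      also have "\<dots> \<le> 4 * G" using total[OF Suc.prems(3,4)] by simp
      finally show ?thesis using K'(1) by (simp add: add_increasing2)
    next
      case False
      let ?X = "{\<kappa> \<in> F. norm \<kappa> \<le> R / 2}" and ?Y = "{\<kappa> \<in> F. \<not> norm \<kappa> \<le> R / 2}"
      let ?s = "\<lambda>F. \<Sum>\<kappa>\<in>F. (norm \<kappa>)\<^sup>2 * w \<kappa>"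
      have "?s F = ?s ?X + ?s ?Y"
        using Suc.prems(3) by (subst sum.union_disjoint[symmetric]) (auto intro: arg_cong[of _ _ ?s])
      also have "?s ?X \<le> 4 * G + K' * (R / 2) powr (2 - 2 * \<beta>)"
        using Suc.prems False by (intro Suc.IH) auto
      also have "(R / 2) powr (2 - 2 * \<beta>) = R powr (2 - 2 * \<beta>) / p"
        using False by (simp add: powr_divide p_def)
      also have "?s ?Y \<le> b * R powr (2 - 2 * \<beta>)"
      proof -
        have "?s ?Y \<le> R\<^sup>2 * sum w ?Y" using Suc.prems(5) by (intro crude) auto
        also have "\<dots> \<le> R\<^sup>2 * (K * (R / 2) powr (- 2 * \<beta>))"
          using Suc.prems False by (intro mult_left_mono tail) auto
        also have "\<dots> = b * (R powr 2 * R powr (- 2 * \<beta>))"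
          using False by (simp add: powr_divide b_def powr_minus field_simps)
        also have "R powr 2 * R powr (- 2 * \<beta>) = R powr (2 - 2 * \<beta>)"
          by (simp flip: powr_add)
        finally show ?thesis .
      qed
      also have "4 * G + K' * (R powr (2 - 2 * \<beta>) / p) + b * R powr (2 - 2 * \<beta>) = 4 * G + (K' / p + b) * R powr (2 - 2 * \<beta>)"
        by (simp add: algebra_simps)
      finally show ?thesis unfolding K'(2) by simp
    qed
  qed
  have main: "(\<Sum>\<kappa>\<in>F. (norm \<kappa>)\<^sup>2 * w \<kappa>) \<le> 4 * G + K' * R powr (2 - 2 * \<beta>)"
    if "R \<ge> 1" "finite F" "F \<subseteq> E" "\<And>\<kappa>. \<kappa> \<in> F \<Longrightarrow> norm \<kappa> \<le> R" for R F
  proof -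
    obtain m where m: "R < 2 ^ m" using real_arch_pow[of 2 R] by auto
    then have "R \<le> 2 ^ Suc m" using that(1) by simp
    from dyadic[OF that(1) this that(2-4)] show ?thesis .
  qed
  show ?thesis by (rule that[OF K'(1) main])
qed

section \<open>Shifts and their Fourier coefficients\<close>

context lattice_domain
begin

abbreviation "shift_diff f h \<equiv> (\<lambda>x. periodic_extension (lattice A) \<Omega> f (x + h) - periodic_extension (lattice A) \<Omega> f x)"

lemma L2_norm_power2: "(L2_norm \<Omega> f)\<^sup>2 = (\<integral>x. (cmod (f x))\<^sup>2 \<partial>M) / vol"
  by (simp add: L2_norm_def)

lemma L2_norm_nonneg: "0 \<le> L2_norm \<Omega> f"
  by (simp add: L2_norm_def)

lemma bessel_norm:
  "f \<in> L2_space \<Omega> \<Longrightarrow> finite F \<Longrightarrow> F \<subseteq> D \<Longrightarrow> (\<Sum>\<kappa>\<in>F. (cmod (fourier_coeff \<Omega> f \<kappa>))\<^sup>2) \<le> (L2_norm \<Omega> f)\<^sup>2"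
  unfolding L2_norm_power2 by (rule bessel)

lemma parseval_norm_le:
  assumes "f \<in> L2_space \<Omega>" "0 \<le> B"
    and "\<And>F. finite F \<Longrightarrow> F \<subseteq> D \<Longrightarrow> (\<Sum>\<kappa>\<in>F. (cmod (fourier_coeff \<Omega> f \<kappa>))\<^sup>2) \<le> B\<^sup>2"
  shows "L2_norm \<Omega> f \<le> B"
proof (rule power2_le_imp_le)
  show "(L2_norm \<Omega> f)\<^sup>2 \<le> B\<^sup>2"
    unfolding L2_norm_power2 using parseval_le[OF assms(1,3)] measure_dom_pos
    by (simp add: pos_divide_le_eq mult.commute)
qed fact

lemma shift_L2:
  assumes "f \<in> L2_space \<Omega>"
  shows "(\<lambda>x. f (rep (x + h))) \<in> L2_space \<Omega>"
  using integrable_shift_rep[OF L2_spaceD(2)[OF assms]] measurable_compose[OF measurable_shift_rep' L2_spaceD(1)[OF assms]]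
  by (simp add: L2_space_def)

text \<open>Periodicity rewrites the character at x through its value at the representative of x +
  h, leaving the factor \<open>chr \<kappa> h\<close>; the shift then preserves the
  integral.\<close>

lemma fourier_coeff_shift:
  assumes f: "f \<in> L2_space \<Omega>" and \<kappa>: "\<kappa> \<in> D"
  shows "fourier_coeff \<Omega> (\<lambda>x. f (rep (x + h))) \<kappa> = chr \<kappa> h * fourier_coeff \<Omega> f \<kappa>"
proof -
  have "chr \<kappa> h * cnj (chr \<kappa> h) = 1" by (simp add: chr_mult_cnj)
  then have eq: "f (rep (x + h)) * cnj (chr \<kappa> x) = chr \<kappa> h * (f (rep (x + h)) * cnj (chr \<kappa> (rep (x + h))))" for x
    by (simp add: chr_rep[OF \<kappa>] chr_add)
  have "(\<integral>x. f (rep (x + h)) * cnj (chr \<kappa> x) \<partial>M) = chr \<kappa> h * (\<integral>x. f (rep (x + h)) * cnj (chr \<kappa> (rep (x + h))) \<partial>M)"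
    unfolding integral_mult_right_zero[symmetric] by (rule Bochner_Integration.integral_cong[OF refl eq])
  also have "(\<integral>x. f (rep (x + h)) * cnj (chr \<kappa> (rep (x + h))) \<partial>M) = (\<integral>x. f x * cnj (chr \<kappa> x) \<partial>M)"
    using integral_shift_rep[OF borel_measurable_integrable[OF L2_space_integrable_mult[OF f chr_L2]]] .
  finally show ?thesis by (simp add: fourier_coeff_chr)
qed

text \<open>The unshifted term is f composed with \<open>rep\<close>, hence the shift by 0.\<close>

lemma shift_diff_L2: "f \<in> L2_space \<Omega> \<Longrightarrow> shift_diff f h \<in> L2_space \<Omega>"
  unfolding periodic_extension_rep using L2_space_diff[OF shift_L2[of f h] shift_L2[of f 0]] by simp

lemma fourier_coeff_shift_diff:
  assumes "f \<in> L2_space \<Omega>" "\<kappa> \<in> D"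
  shows "fourier_coeff \<Omega> (shift_diff f h) \<kappa> = (chr \<kappa> h - 1) * fourier_coeff \<Omega> f \<kappa>"
  using fourier_coeff_shift[OF assms, of h] fourier_coeff_shift[OF assms, of 0]
    fourier_coeff_diff[OF L2_integrable[OF shift_L2[OF assms(1), of h]] L2_integrable[OF shift_L2[OF assms(1), of 0]], of \<kappa>]
  by (simp add: periodic_extension_rep algebra_simps)

text \<open>Testing the Bessel inequality on the shifts along the coordinate axes by \<open>1 / (4 R)\<close>:
  on the shell, the phases stay in the range where the sine is comparable to its argument.\<close>
lemma shell_bound:
  fixes R C \<alpha> :: real
  assumes f: "f \<in> L2_space \<Omega>" and R: "R > 0" and C: "C \<ge> 0"
    and lip: "\<And>h. norm h = 1 / (4 * R) \<Longrightarrow> L2_norm \<Omega> (shift_diff f h) \<le> C * norm h powr \<alpha>"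
    and F: "finite F" "F \<subseteq> D" "\<And>\<kappa>. \<kappa> \<in> F \<Longrightarrow> R < norm \<kappa> \<and> norm \<kappa> \<le> 2 * R"
  shows "(\<Sum>\<kappa>\<in>F. (cmod (fourier_coeff \<Omega> f \<kappa>))\<^sup>2) \<le> CARD('n) * C\<^sup>2 * 4 powr (- 2 * \<alpha>) * R powr (- 2 * \<alpha>)"
proof -
  define t where "t = 1 / (4 * R)"
  have t: "t > 0" "t * R = 1 / 4" using R by (auto simp: t_def)
  let ?h = "\<lambda>i. t *\<^sub>R (axis i 1 :: real^'n)" and ?c = "fourier_coeff \<Omega> f"
  have h: "norm (?h i) = t" for i using t by simp
  \<comment> \<open>Along axis i the phase t \<kappa>_i is at most 1/2 in size, so the factor is at
    least 4 t |\<kappa>_i|. Squares summed over the axes give (4 t |\<kappa>|)^2, and 4 t R =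
    1.\<close>
  have ge1: "1 \<le> (\<Sum>i\<in>UNIV. (cmod (chr \<kappa> (?h i) - 1))\<^sup>2)" if "\<kappa> \<in> F" for \<kappa>
  proof -
    have "(4 * (t * (\<kappa> $ i)))\<^sup>2 \<le> (cmod (chr \<kappa> (?h i) - 1))\<^sup>2" for i
    proof -
      have "\<bar>\<kappa> $ i\<bar> \<le> 2 * R" using F(3)[OF that] component_le_norm_cart[of \<kappa> i] by linarith
      then have "t * \<bar>\<kappa> $ i\<bar> \<le> t * (2 * R)" using t(1) by (intro mult_left_mono) auto
      also have "\<dots> = 1/2" using t(2) by simp
      finally have "t * \<bar>\<kappa> $ i\<bar> \<le> 1/2" .
      then have "4 * \<bar>t * (\<kappa> $ i)\<bar> \<le> cmod (chr \<kappa> (?h i) - 1)"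
        using norm_chr_minus_1_ge[of \<kappa> "?h i"] t(1) by (simp add: inner_axis abs_mult)
      then have "(4 * \<bar>t * (\<kappa> $ i)\<bar>)\<^sup>2 \<le> (cmod (chr \<kappa> (?h i) - 1))\<^sup>2" by (intro power_mono) auto
      then show ?thesis by (simp add: power_mult_distrib)
    qed
    then have "(\<Sum>i\<in>UNIV. (4 * (t * (\<kappa> $ i)))\<^sup>2) \<le> (\<Sum>i\<in>UNIV. (cmod (chr \<kappa> (?h i) - 1))\<^sup>2)"
      by (intro sum_mono)
    moreover have "(\<Sum>i\<in>UNIV. (4 * (t * (\<kappa> $ i)))\<^sup>2) = (4 * t * norm \<kappa>)\<^sup>2"
      by (simp add: power_mult_distrib norm_vec_def L2_set_def sum_nonneg sum_distrib_left mult.assoc)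
    moreover have "1 \<le> 4 * t * norm \<kappa>"
      using F(3)[OF that] mult_left_mono[of R "norm \<kappa>" t] t by simp
    then have "1 \<le> (4 * t * norm \<kappa>)\<^sup>2" by (rule one_le_power)
    ultimately show ?thesis by linarith
  qed
  have "(\<Sum>\<kappa>\<in>F. (cmod (?c \<kappa>))\<^sup>2) \<le> (\<Sum>\<kappa>\<in>F. (cmod (?c \<kappa>))\<^sup>2 * (\<Sum>i\<in>UNIV. (cmod (chr \<kappa> (?h i) - 1))\<^sup>2))"
  proof (rule sum_mono)
    fix \<kappa> assume "\<kappa> \<in> F"
    from mult_left_mono[OF ge1[OF this], of "(cmod (?c \<kappa>))\<^sup>2"]
    show "(cmod (?c \<kappa>))\<^sup>2 \<le> (cmod (?c \<kappa>))\<^sup>2 * (\<Sum>i\<in>UNIV. (cmod (chr \<kappa> (?h i) - 1))\<^sup>2)" by simp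
  qed
  \<comment> \<open>Each axis now carries one Bessel sum, whence the factor
    \<open>CARD('n)\<close>.\<close>
  also have "\<dots> = (\<Sum>i\<in>UNIV. \<Sum>\<kappa>\<in>F. (cmod ((chr \<kappa> (?h i) - 1) * ?c \<kappa>))\<^sup>2)"
    unfolding sum_distrib_left by (subst sum.swap) (simp add: norm_mult power_mult_distrib mult.commute)
  also have "\<dots> = (\<Sum>i\<in>UNIV. \<Sum>\<kappa>\<in>F. (cmod (fourier_coeff \<Omega> (shift_diff f (?h i)) \<kappa>))\<^sup>2)"
    using F(2) by (intro sum.cong refl) (auto simp: fourier_coeff_shift_diff[OF f])
  also have "\<dots> \<le> (\<Sum>i\<in>(UNIV :: 'n set). (C * t powr \<alpha>)\<^sup>2)"
  proof (rule sum_mono)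
    fix i
    have "(\<Sum>\<kappa>\<in>F. (cmod (fourier_coeff \<Omega> (shift_diff f (?h i)) \<kappa>))\<^sup>2) \<le> (L2_norm \<Omega> (shift_diff f (?h i)))\<^sup>2"
      by (rule bessel_norm[OF shift_diff_L2[OF f] F(1,2)])
    also have "\<dots> \<le> (C * t powr \<alpha>)\<^sup>2"
    proof (rule power_mono[OF _ L2_norm_nonneg])
      have "norm (?h i) = 1 / (4 * R)" using h[of i] by (simp only: t_def)
      from lip[OF this] show "L2_norm \<Omega> (shift_diff f (?h i)) \<le> C * t powr \<alpha>" by (simp only: h)
    qed
    finally show "(\<Sum>\<kappa>\<in>F. (cmod (fourier_coeff \<Omega> (shift_diff f (?h i)) \<kappa>))\<^sup>2) \<le> (C * t powr \<alpha>)\<^sup>2" .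
  qed
  also have "\<dots> = CARD('n) * C\<^sup>2 * (4 powr (- 2 * \<alpha>) * R powr (- 2 * \<alpha>))"
  proof -
    have "(t powr \<alpha>)\<^sup>2 = (4 * R) powr (- 2 * \<alpha>)"
      using R by (simp add: t_def powr_divide powr_minus_divide power_divide power2_eq_square flip: powr_add)
    also have "\<dots> = 4 powr (- 2 * \<alpha>) * R powr (- 2 * \<alpha>)" using R by (simp add: powr_mult)
    finally show ?thesis by (simp add: power_mult_distrib)
  qed
  finally show ?thesis by (simp add: mult.assoc)
qed

text \<open>The Lipschitz condition governs only small shifts, hence only radii beyond some
  \<open>R0\<close>; smaller radii are paid for by the total norm.\<close>

lemma Lip2_tail_bound:
  assumes f: "f \<in> Lip2 A \<Omega> \<alpha>" and \<alpha>: "\<alpha> > 0"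
  obtains K where "K \<ge> 0" "\<And>R F. R \<ge> 1 \<Longrightarrow> finite F \<Longrightarrow> F \<subseteq> D \<Longrightarrow> (\<And>\<kappa>. \<kappa> \<in> F \<Longrightarrow> R < norm \<kappa>)
    \<Longrightarrow> (\<Sum>\<kappa>\<in>F. (cmod (fourier_coeff \<Omega> f \<kappa>))\<^sup>2) \<le> K * R powr (- 2 * \<alpha>)"
proof -
  let ?w = "\<lambda>\<kappa>. (cmod (fourier_coeff \<Omega> f \<kappa>))\<^sup>2"
  have fL2: "f \<in> L2_space \<Omega>" using f by (simp add: Lip2_def)
  obtain C d where C: "C > 0" and d: "d > 0"
    and lip: "\<And>h. norm h < d \<Longrightarrow> L2_norm \<Omega> (shift_diff f h) \<le> C * norm h powr \<alpha>"
    using f by (auto simp: Lip2_def eventually_nhds_metric)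
  \<comment> \<open>From this radius on, shifts of length 1 / (4 R) are shorter than
    \<open>d\<close>.\<close>
  define R0 where "R0 = 1 / d"
  have R0: "R0 > 0" using d by (simp add: R0_def)
  define a where "a = CARD('n) * C\<^sup>2 * 4 powr (- 2 * \<alpha>)"
  define K1 where "K1 = a / (1 - 2 powr (- 2 * \<alpha>))"
  define N where "N = (L2_norm \<Omega> f)\<^sup>2"
  have K1: "sum ?w F \<le> K1 * R powr (- 2 * \<alpha>)"
    if "R \<ge> R0" "finite F" "F \<subseteq> D" "\<And>\<kappa>. \<kappa> \<in> F \<Longrightarrow> R < norm \<kappa>" for R F
    unfolding K1_def
  proof (rule dyadic_tail_bound[OF \<alpha> R0 _ that])
    fix R F assume RF: "R0 \<le> R" "finite F" "F \<subseteq> D" "\<And>\<kappa>. \<kappa> \<in> F \<Longrightarrow> R < norm \<kappa> \<and> norm \<kappa> \<le> 2 * R"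
    show "sum ?w F \<le> a * R powr (- 2 * \<alpha>)"
      unfolding a_def
    proof (rule shell_bound[OF fL2 _ _ lip RF(2-4)])
      fix h :: "real^'n" assume "norm h = 1 / (4 * R)"
      moreover have "1 / (4 * R) < d"
      proof -
        have "1 \<le> R * d" using RF(1) d by (simp add: R0_def pos_divide_le_eq)
        then have "1 < 4 * (R * d)" by linarith
        then show ?thesis using RF(1) R0 by (simp add: pos_divide_less_eq mult_ac)
      qed
      ultimately show "norm h < d" by simp
    qed (use R0 RF C in auto)
  qed
  show ?thesis
  proof (rule that)
    have "1 - 2 powr (- 2 * \<alpha>) \<ge> 0"
      using \<alpha> powr_mono[of "- 2 * \<alpha>" 0 "2::real"] by simp
    then have K1_nonneg: "K1 \<ge> 0" by (simp add: K1_def a_def)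
    have N: "N \<ge> 0" by (simp add: N_def)
    \<comment> \<open>Below \<open>R0\<close> the second summand suffices, because there R^(-2
      \<alpha>) \<ge> R0^(-2 \<alpha>).\<close>
    show "K1 + N * R0 powr (2 * \<alpha>) \<ge> 0" using K1_nonneg N by simp
    fix R :: real and F assume RF: "R \<ge> 1" "finite F" "F \<subseteq> D" "\<And>\<kappa>. \<kappa> \<in> F \<Longrightarrow> R < norm \<kappa>"
    have distr: "(K1 + N * R0 powr (2 * \<alpha>)) * R powr (- 2 * \<alpha>) = K1 * R powr (- 2 * \<alpha>) + N * (R0 powr (2 * \<alpha>) * R powr (- 2 * \<alpha>))"
      by (simp add: algebra_simps)
    show "sum ?w F \<le> (K1 + N * R0 powr (2 * \<alpha>)) * R powr (- 2 * \<alpha>)"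
    proof (cases "R \<ge> R0")
      case True
      then show ?thesis using K1[OF True RF(2-4)] N unfolding distr
        by (intro order.trans[OF _ add_increasing2[OF _ order.refl]]) auto
    next
      case False
      have "sum ?w F \<le> N" unfolding N_def by (rule bessel_norm[OF fL2 RF(2,3)])
      also have "\<dots> \<le> N * (R0 powr (2 * \<alpha>) * R powr (- 2 * \<alpha>))"
      proof -
        have "R powr (2 * \<alpha>) \<le> R0 powr (2 * \<alpha>)" using False RF(1) \<alpha> by (intro powr_mono2) auto
        then have "1 \<le> R0 powr (2 * \<alpha>) * R powr (- 2 * \<alpha>)"
          using RF(1) by (simp add: powr_minus field_simps)
        then show ?thesis using mult_left_mono[OF _ N, of 1] by simp
      qed
      finally show ?thesis using K1_nonneg unfolding distr by (simp add: add_increasing)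
    qed
  qed
qed

text \<open>Split at |\<kappa>| = 1/|h|. Below, the factor is at most 2 pi |\<kappa>| |h| and the
  second moment is bounded; above, it is at most 2 and the tail is small. Both parts are O(|h|^(2
  \<beta>)).\<close>

lemma Lip2_of_tail_bound:
  assumes g: "g \<in> L2_space \<Omega>" and \<beta>: "0 < \<beta>" "\<beta> < 1" and K: "K \<ge> 0"
    and tail: "\<And>R F. R \<ge> 1 \<Longrightarrow> finite F \<Longrightarrow> F \<subseteq> D \<Longrightarrow> (\<And>\<kappa>. \<kappa> \<in> F \<Longrightarrow> R < norm \<kappa>)
      \<Longrightarrow> (\<Sum>\<kappa>\<in>F. (cmod (fourier_coeff \<Omega> g \<kappa>))\<^sup>2) \<le> K * R powr (- 2 * \<beta>)"
  shows "g \<in> Lip2 A \<Omega> \<beta>"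
proof -
  let ?w = "\<lambda>\<kappa>. (cmod (fourier_coeff \<Omega> g \<kappa>))\<^sup>2"
  define G where "G = (L2_norm \<Omega> g)\<^sup>2"
  have G: "G \<ge> 0" by (simp add: G_def)
  have total: "sum ?w F \<le> G" if "finite F" "F \<subseteq> D" for F
    unfolding G_def by (rule bessel_norm[OF g that])
  obtain K' where K': "K' \<ge> 0" and moment: "\<And>R F. R \<ge> 1 \<Longrightarrow> finite F \<Longrightarrow> F \<subseteq> D \<Longrightarrow> (\<And>\<kappa>. \<kappa> \<in> F \<Longrightarrow> norm \<kappa> \<le> R)
    \<Longrightarrow> (\<Sum>\<kappa>\<in>F. (norm \<kappa>)\<^sup>2 * ?w \<kappa>) \<le> 4 * G + K' * R powr (2 - 2 * \<beta>)"
    using dyadic_moment_bound[of \<beta> ?w K D G] \<beta>(2) K total tail by auto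
  \<comment> \<open>The term with 4 pi^2 comes from the low frequencies, \<open>4 * K\<close> from
    the high ones; the 1 ensures positivity.\<close>
  define C where "C = 4 * pi\<^sup>2 * (4 * G + K') + 4 * K + 1"
  have C: "C > 0" using G K K' by (simp add: C_def add_nonneg_pos)
  have "L2_norm \<Omega> (shift_diff g h) \<le> sqrt C * norm h powr \<beta>" if h: "norm h < 1" for h
  proof (rule parseval_norm_le[OF shift_diff_L2[OF g]])
    show "0 \<le> sqrt C * norm h powr \<beta>" using C by simp
    fix F assume F: "finite F" "F \<subseteq> D"
    have eq: "(\<Sum>\<kappa>\<in>F. (cmod (fourier_coeff \<Omega> (shift_diff g h) \<kappa>))\<^sup>2) = (\<Sum>\<kappa>\<in>F. (cmod (chr \<kappa> h - 1))\<^sup>2 * ?w \<kappa>)"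
      using F(2) by (intro sum.cong refl) (auto simp: fourier_coeff_shift_diff[OF g] norm_mult power_mult_distrib)
    show "(\<Sum>\<kappa>\<in>F. (cmod (fourier_coeff \<Omega> (shift_diff g h) \<kappa>))\<^sup>2) \<le> (sqrt C * norm h powr \<beta>)\<^sup>2"
    \<comment> \<open>At h = 0 there is no split radius, but every factor
      \<open>chr \<kappa> h - 1\<close> vanishes.\<close>
    proof (cases "h = 0")
      case True
      then show ?thesis unfolding eq by simp
    next
      case False
      define r where "r = norm h"
      have r: "r > 0" "r \<le> 1" using False h by (auto simp: r_def)
      let ?X = "{\<kappa> \<in> F. norm \<kappa> \<le> 1 / r}" and ?Y = "{\<kappa> \<in> F. \<not> norm \<kappa> \<le> 1 / r}"
      let ?s = "\<lambda>F. \<Sum>\<kappa>\<in>F. (cmod (chr \<kappa> h - 1))\<^sup>2 * ?w \<kappa>"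
      have "?s F = ?s ?X + ?s ?Y"
        using F(1) by (subst sum.union_disjoint[symmetric]) (auto intro: arg_cong[of _ _ ?s])
      also have "?s ?X \<le> (2 * pi * r)\<^sup>2 * (4 * G + K' * (1 / r) powr (2 - 2 * \<beta>))"
      proof -
        have "?s ?X \<le> (\<Sum>\<kappa>\<in>?X. (2 * pi * r)\<^sup>2 * ((norm \<kappa>)\<^sup>2 * ?w \<kappa>))"
        proof (rule sum_mono)
          fix \<kappa>
          have "(cmod (chr \<kappa> h - 1))\<^sup>2 \<le> (2 * pi * norm \<kappa> * r)\<^sup>2"
            unfolding r_def by (intro power_mono norm_chr_minus_1_le) simp
          then have "(cmod (chr \<kappa> h - 1))\<^sup>2 * ?w \<kappa> \<le> (2 * pi * norm \<kappa> * r)\<^sup>2 * ?w \<kappa>"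
            by (rule mult_right_mono) simp
          then show "(cmod (chr \<kappa> h - 1))\<^sup>2 * ?w \<kappa> \<le> (2 * pi * r)\<^sup>2 * ((norm \<kappa>)\<^sup>2 * ?w \<kappa>)"
            by (simp add: power_mult_distrib mult_ac)
        qed
        also have "\<dots> = (2 * pi * r)\<^sup>2 * (\<Sum>\<kappa>\<in>?X. (norm \<kappa>)\<^sup>2 * ?w \<kappa>)"
          by (simp add: sum_distrib_left)
        also have "\<dots> \<le> (2 * pi * r)\<^sup>2 * (4 * G + K' * (1 / r) powr (2 - 2 * \<beta>))"
          using F r by (intro mult_left_mono moment) auto
        finally show ?thesis .
      qed
      also have "?s ?Y \<le> 4 * (K * (1 / r) powr (- 2 * \<beta>))"
      proof -
        have "?s ?Y \<le> (\<Sum>\<kappa>\<in>?Y. 4 * ?w \<kappa>)"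
        proof (rule sum_mono)
          fix \<kappa>
          have "cmod (chr \<kappa> h - 1) \<le> 2" using norm_triangle_ineq4[of "chr \<kappa> h" 1] by simp
          then have "(cmod (chr \<kappa> h - 1))\<^sup>2 \<le> 2\<^sup>2" by (rule power_mono) simp
          then show "(cmod (chr \<kappa> h - 1))\<^sup>2 * ?w \<kappa> \<le> 4 * ?w \<kappa>" by (intro mult_right_mono) auto
        qed
        also have "\<dots> = 4 * sum ?w ?Y" by (simp add: sum_distrib_left)
        also have "\<dots> \<le> 4 * (K * (1 / r) powr (- 2 * \<beta>))"
          using F r by (intro mult_left_mono tail) auto
        finally show ?thesis .
      qed
      also have "(2 * pi * r)\<^sup>2 * (4 * G + K' * (1 / r) powr (2 - 2 * \<beta>)) + 4 * (K * (1 / r) powr (- 2 * \<beta>))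
          = 4 * pi\<^sup>2 * (4 * G) * r powr 2 + (4 * pi\<^sup>2 * K' + 4 * K) * r powr (2 * \<beta>)"
      proof -
        have e1: "(1 / r) powr (- 2 * \<beta>) = r powr (2 * \<beta>)"
          using r by (simp add: powr_divide powr_minus)
        have e2: "r\<^sup>2 * (1 / r) powr (2 - 2 * \<beta>) = r powr (2 * \<beta>)"
          using r by (simp add: powr_divide powr_diff)
        have e3: "(2 * pi * r)\<^sup>2 * (4 * G + K' * (1 / r) powr (2 - 2 * \<beta>)) =
            4 * pi\<^sup>2 * (4 * G) * r\<^sup>2 + 4 * pi\<^sup>2 * K' * (r\<^sup>2 * (1 / r) powr (2 - 2 * \<beta>))"
          by (simp add: power_mult_distrib distrib_left mult_ac)
        have e4: "r powr 2 = r\<^sup>2" using r by simp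
        show ?thesis unfolding e3 e2 e1 e4 by (simp add: distrib_right)
      qed
      \<comment> \<open>Here r \<le> 1 and \<beta> < 1 are used; r \<le> 1 also keeps the split
        radius at least 1.\<close>
      also have "4 * pi\<^sup>2 * (4 * G) * r powr 2 \<le> 4 * pi\<^sup>2 * (4 * G) * r powr (2 * \<beta>)"
        using r \<beta> G by (intro mult_left_mono powr_mono') auto
      also have "4 * pi\<^sup>2 * (4 * G) * r powr (2 * \<beta>) + (4 * pi\<^sup>2 * K' + 4 * K) * r powr (2 * \<beta>) \<le> C * r powr (2 * \<beta>)"
        by (simp add: C_def algebra_simps)
      also have "\<dots> = (sqrt C * norm h powr \<beta>)\<^sup>2"
      proof -
        have "(norm h powr \<beta>)\<^sup>2 = r powr (2 * \<beta>)"
          by (simp only: r_def power2_eq_square mult_2 powr_add)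
        then show ?thesis using C by (simp add: power_mult_distrib)
      qed
      finally show ?thesis unfolding eq by simp
    qed
  qed
  then have "\<forall>\<^sub>F h in nhds 0. L2_norm \<Omega> (shift_diff g h) \<le> sqrt C * norm h powr \<beta>"
    unfolding eventually_nhds_metric by (intro exI[of _ 1]) simp
  then show ?thesis
    using g C unfolding Lip2_def by (auto intro!: exI[of _ "sqrt C"])
qed

end

section \<open>Multipliers with decaying symbol\<close>

lemma japanese_bracket_powr_le:
  assumes "\<gamma> \<ge> 0" "R \<ge> 1" "R < norm \<kappa>"
  shows "japanese_bracket \<kappa> powr (- \<gamma>) \<le> R powr (- \<gamma>)"
proof -
  have "norm \<kappa> \<le> japanese_bracket \<kappa>"
    unfolding japanese_bracket_def by (rule real_le_rsqrt) simp
  then show ?thesis using assms by (intro powr_mono2') auto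
qed

lemma japanese_bracket_powr_le_1: "\<gamma> \<ge> 0 \<Longrightarrow> japanese_bracket \<kappa> powr (- \<gamma>) \<le> 1"
  using powr_mono2'[of "- \<gamma>" 1 "japanese_bracket \<kappa>"] by (simp add: japanese_bracket_def)

context lattice_domain
begin

text \<open>An \<open>infsum\<close> over a family that is not summable is 0, so comparing tails
  requires summability on both sides.\<close>

lemma fourier_coeff_summable:
  assumes "f \<in> L2_space \<Omega>" "E \<subseteq> D"
  shows "(\<lambda>\<kappa>. (cmod (fourier_coeff \<Omega> f \<kappa>))\<^sup>2) summable_on E"
  using bessel_norm[OF assms(1)] assms(2)
  by (intro nonneg_bdd_above_summable_on bdd_aboveI2[where M = "(L2_norm \<Omega> f)\<^sup>2"]) auto

end

locale decaying_symbol = lattice_domain A \<Omega>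
  for A :: "real^'n^'n" and \<Omega> +
  fixes \<sigma> :: "real^'n \<Rightarrow> complex" and \<gamma> C :: real
  assumes \<gamma>: "0 \<le> \<gamma>" and C: "C > 0"
    and \<sigma>: "\<kappa> \<in> D \<Longrightarrow> cmod (\<sigma> \<kappa>) \<le> C * japanese_bracket \<kappa> powr (- \<gamma>)"
begin

lemma symbol_le: "\<kappa> \<in> D \<Longrightarrow> cmod (\<sigma> \<kappa>) \<le> C"
  using order.trans[OF \<sigma> mult_left_mono[OF japanese_bracket_powr_le_1[OF \<gamma>] less_imp_le[OF C]]] by simp

lemma symbol_le_powr: "\<kappa> \<in> D \<Longrightarrow> R \<ge> 1 \<Longrightarrow> R < norm \<kappa> \<Longrightarrow> cmod (\<sigma> \<kappa>) \<le> C * R powr (- \<gamma>)"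
  using order.trans[OF \<sigma> mult_left_mono[OF japanese_bracket_powr_le[OF \<gamma>] less_imp_le[OF C]]] by simp

text \<open>This supplies the hypothesis of Riesz-Fischer for the existence of T, and that of
  Parseval for its L2 bound.\<close>

lemma multiplied_coeffs_bound:
  assumes "f \<in> L2_space \<Omega>" "finite F" "F \<subseteq> D"
  shows "(\<Sum>\<kappa>\<in>F. (cmod (\<sigma> \<kappa> * fourier_coeff \<Omega> f \<kappa>))\<^sup>2) \<le> (C * L2_norm \<Omega> f)\<^sup>2"
proof -
  have "(\<Sum>\<kappa>\<in>F. (cmod (\<sigma> \<kappa> * fourier_coeff \<Omega> f \<kappa>))\<^sup>2) \<le> (\<Sum>\<kappa>\<in>F. C\<^sup>2 * (cmod (fourier_coeff \<Omega> f \<kappa>))\<^sup>2)"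
    unfolding norm_mult power_mult_distrib using assms(3) symbol_le
    by (intro sum_mono mult_right_mono power_mono) auto
  also have "\<dots> = C\<^sup>2 * (\<Sum>\<kappa>\<in>F. (cmod (fourier_coeff \<Omega> f \<kappa>))\<^sup>2)"
    by (simp add: sum_distrib_left)
  also have "\<dots> \<le> C\<^sup>2 * (L2_norm \<Omega> f)\<^sup>2"
    by (intro mult_left_mono bessel_norm assms) simp
  finally show ?thesis by (simp add: power_mult_distrib)
qed

text \<open>Riesz-Fischer for each f separately, then choice; it shows that the claim about all
  multipliers is not vacuous.\<close>

lemma multiplier_exists: "\<exists>T. is_fourier_multiplier A \<Omega> \<sigma> T"
proof -
  have "\<exists>g. f \<in> L2_space \<Omega> \<longrightarrow> g \<in> L2_space \<Omega> \<and>
      (\<forall>\<kappa>\<in>D. fourier_coeff \<Omega> g \<kappa> = \<sigma> \<kappa> * fourier_coeff \<Omega> f \<kappa>)" for f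
    using riesz_fischer[OF multiplied_coeffs_bound] by metis
  then obtain T where "\<And>f. f \<in> L2_space \<Omega> \<longrightarrow> T f \<in> L2_space \<Omega> \<and>
      (\<forall>\<kappa>\<in>D. fourier_coeff \<Omega> (T f) \<kappa> = \<sigma> \<kappa> * fourier_coeff \<Omega> f \<kappa>)" by metis
  then show ?thesis by (auto simp: is_fourier_multiplier_def)
qed

context
  fixes T :: "(real^'n \<Rightarrow> complex) \<Rightarrow> real^'n \<Rightarrow> complex"
  assumes T: "is_fourier_multiplier A \<Omega> \<sigma> T"
begin

lemma multiplier_L2: "f \<in> L2_space \<Omega> \<Longrightarrow> T f \<in> L2_space \<Omega>"
  using T by (simp add: is_fourier_multiplier_def)

lemma fourier_coeff_multiplier:
  "f \<in> L2_space \<Omega> \<Longrightarrow> \<kappa> \<in> D \<Longrightarrow> fourier_coeff \<Omega> (T f) \<kappa> = \<sigma> \<kappa> * fourier_coeff \<Omega> f \<kappa>"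
  using T by (simp add: is_fourier_multiplier_def)

lemma fourier_coeff_multiplier_le:
  assumes "f \<in> L2_space \<Omega>" "\<kappa> \<in> D" "R \<ge> 1" "R < norm \<kappa>"
  shows "(cmod (fourier_coeff \<Omega> (T f) \<kappa>))\<^sup>2 \<le> (C * R powr (- \<gamma>))\<^sup>2 * (cmod (fourier_coeff \<Omega> f \<kappa>))\<^sup>2"
  unfolding fourier_coeff_multiplier[OF assms(1,2)] norm_mult power_mult_distrib[of "cmod (\<sigma> \<kappa>)"]
  using symbol_le_powr[OF assms(2-4)] by (intro mult_right_mono power_mono) auto

text \<open>\<open>T f\<close> is known only through its coefficients, so its norm is reached by
  Parseval.\<close>

lemma L2_norm_multiplier_le:
  assumes "f \<in> L2_space \<Omega>"
  shows "L2_norm \<Omega> (T f) \<le> C * L2_norm \<Omega> f"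
proof (rule parseval_norm_le[OF multiplier_L2[OF assms]])
  show "0 \<le> C * L2_norm \<Omega> f" using C L2_norm_nonneg by simp
  fix F assume F: "finite F" "F \<subseteq> D"
  have "(\<Sum>\<kappa>\<in>F. (cmod (fourier_coeff \<Omega> (T f) \<kappa>))\<^sup>2) = (\<Sum>\<kappa>\<in>F. (cmod (\<sigma> \<kappa> * fourier_coeff \<Omega> f \<kappa>))\<^sup>2)"
    using F(2) by (intro sum.cong refl) (auto simp: fourier_coeff_multiplier[OF assms])
  also have "\<dots> \<le> (C * L2_norm \<Omega> f)\<^sup>2" by (rule multiplied_coeffs_bound[OF assms F])
  finally show "(\<Sum>\<kappa>\<in>F. (cmod (fourier_coeff \<Omega> (T f) \<kappa>))\<^sup>2) \<le> (C * L2_norm \<Omega> f)\<^sup>2" .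
qed

text \<open>The tail constant \<open>K\<close> of f becomes \<open>C\<^sup>2 * K\<close>, and
  \<alpha> < 1 - \<gamma> permits the return from tails to differences.\<close>

lemma multiplier_Lip2:
  assumes f: "f \<in> Lip2 A \<Omega> \<alpha>" and \<alpha>: "0 < \<alpha>" "\<alpha> < 1 - \<gamma>"
  shows "T f \<in> Lip2 A \<Omega> (\<alpha> + \<gamma>)"
proof -
  have fL2: "f \<in> L2_space \<Omega>" using f by (simp add: Lip2_def)
  obtain K where K: "K \<ge> 0" and tail: "\<And>R F. R \<ge> 1 \<Longrightarrow> finite F \<Longrightarrow> F \<subseteq> D \<Longrightarrow> (\<And>\<kappa>. \<kappa> \<in> F \<Longrightarrow> R < norm \<kappa>)
    \<Longrightarrow> (\<Sum>\<kappa>\<in>F. (cmod (fourier_coeff \<Omega> f \<kappa>))\<^sup>2) \<le> K * R powr (- 2 * \<alpha>)"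
    using Lip2_tail_bound[OF f \<alpha>(1)] by metis
  show ?thesis
  proof (rule Lip2_of_tail_bound[OF multiplier_L2[OF fL2]])
    show "0 < \<alpha> + \<gamma>" "\<alpha> + \<gamma> < 1" "0 \<le> C\<^sup>2 * K" using \<alpha> \<gamma> K by auto
    fix R :: real and F assume RF: "R \<ge> 1" "finite F" "F \<subseteq> D" "\<And>\<kappa>. \<kappa> \<in> F \<Longrightarrow> R < norm \<kappa>"
    have "(\<Sum>\<kappa>\<in>F. (cmod (fourier_coeff \<Omega> (T f) \<kappa>))\<^sup>2) \<le> (\<Sum>\<kappa>\<in>F. (C * R powr (- \<gamma>))\<^sup>2 * (cmod (fourier_coeff \<Omega> f \<kappa>))\<^sup>2)"
      using RF by (intro sum_mono fourier_coeff_multiplier_le fL2) auto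
    also have "\<dots> \<le> (C * R powr (- \<gamma>))\<^sup>2 * (K * R powr (- 2 * \<alpha>))"
      unfolding sum_distrib_left[symmetric] by (intro mult_left_mono tail RF) auto
    also have "\<dots> = C\<^sup>2 * K * (R powr (- \<gamma>) * R powr (- \<gamma>) * R powr (- 2 * \<alpha>))"
      by (simp only: power2_eq_square mult_ac)
    also have "R powr (- \<gamma>) * R powr (- \<gamma>) * R powr (- 2 * \<alpha>) = R powr (- 2 * (\<alpha> + \<gamma>))"
      by (simp add: algebra_simps flip: powr_add)
    finally show "(\<Sum>\<kappa>\<in>F. (cmod (fourier_coeff \<Omega> (T f) \<kappa>))\<^sup>2) \<le> C\<^sup>2 * K * R powr (- 2 * (\<alpha> + \<gamma>))" .
  qed
qed

text \<open>The terms of the supremum compare one by one: the tail gains N^(-\<gamma>), which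
  cancels the extra N^\<gamma> in the weight.\<close>

lemma Lip2_norm_multiplier_le:
  assumes f: "f \<in> L2_space \<Omega>"
  shows "Lip2_norm A \<Omega> (\<alpha> + \<gamma>) (T f) \<le> ennreal C * Lip2_norm A \<Omega> \<alpha> f"
proof -
  define E where "E N = {\<kappa> \<in> D. norm \<kappa> > real N}" for N
  define t where "t \<beta> g N = ennreal (real N powr \<beta> * sqrt (\<Sum>\<^sub>\<infinity>\<kappa>\<in>E N. (cmod (fourier_coeff \<Omega> g \<kappa>))\<^sup>2))"
    for \<beta> g N
  have ED: "E N \<subseteq> D" for N by (auto simp: E_def)
  have term_le: "t (\<alpha> + \<gamma>) (T f) N \<le> ennreal C * t \<alpha> f N" for N
  proof (cases "N = 0")
    case True
    \<comment> \<open>\<open>0 powr \<beta> = 0\<close>, so the index \<open>N = 0\<close> contributes nothing to the supremum\<close>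
    then show ?thesis by (simp add: t_def)
  next
    case False
    let ?r = "real N powr (- \<gamma>)" and ?S = "\<lambda>g. \<Sum>\<^sub>\<infinity>\<kappa>\<in>E N. (cmod (fourier_coeff \<Omega> g \<kappa>))\<^sup>2"
    have "?S (T f) \<le> (\<Sum>\<^sub>\<infinity>\<kappa>\<in>E N. (C * ?r)\<^sup>2 * (cmod (fourier_coeff \<Omega> f \<kappa>))\<^sup>2)"
      using False fourier_coeff_multiplier_le[OF f, of _ "real N"]
      by (intro infsum_mono fourier_coeff_summable summable_on_cmult_right multiplier_L2 f ED) (auto simp: E_def)
    also have "\<dots> = (C * ?r)\<^sup>2 * ?S f" by (rule infsum_cmult_right')
    finally have "sqrt (?S (T f)) \<le> sqrt ((C * ?r)\<^sup>2 * ?S f)" by (rule real_sqrt_le_mono)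
    also have "\<dots> = C * ?r * sqrt (?S f)" using C by (simp add: real_sqrt_mult)
    finally have "real N powr (\<alpha> + \<gamma>) * sqrt (?S (T f)) \<le> real N powr (\<alpha> + \<gamma>) * (C * ?r * sqrt (?S f))"
      by (rule mult_left_mono) simp
    also have "\<dots> = C * ((real N powr (\<alpha> + \<gamma>) * ?r) * sqrt (?S f))"
      by (simp only: mult_ac)
    also have "real N powr (\<alpha> + \<gamma>) * ?r = real N powr \<alpha>"
      by (simp flip: powr_add)
    finally show ?thesis using C by (simp add: t_def ennreal_leI flip: ennreal_mult')
  qed
  have "(SUP N. t (\<alpha> + \<gamma>) (T f) N) \<le> ennreal C * (SUP N. t \<alpha> f N)"
  proof (rule SUP_least)
    fix N
    have "t \<alpha> f N \<le> (SUP N. t \<alpha> f N)" by (rule SUP_upper) simp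
    from order.trans[OF term_le mult_left_mono[OF this]]
    show "t (\<alpha> + \<gamma>) (T f) N \<le> ennreal C * (SUP N. t \<alpha> f N)" by simp
  qed
  moreover have "ennreal (L2_norm \<Omega> (T f)) \<le> ennreal C * ennreal (L2_norm \<Omega> f)"
    using L2_norm_multiplier_le[OF f] C by (simp add: ennreal_leI flip: ennreal_mult')
  ultimately show ?thesis
    unfolding Lip2_norm_def distrib_left t_def E_def by (rule add_mono[rotated])
qed

end

end

theorem theoremC:
  fixes A :: "real^'n^'n" and \<Omega> :: "(real^'n) set"
    and \<sigma> :: "real^'n \<Rightarrow> complex" and \<gamma> C :: real
  assumes "invertible A"
    and "fundamental_domain (lattice A) \<Omega>"
    and "0 \<le> \<gamma>" and "\<gamma> < 1"
    and "C > 0"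
    and "\<forall>\<kappa> \<in> dual_lattice A. cmod (\<sigma> \<kappa>) \<le> C * japanese_bracket \<kappa> powr (- \<gamma>)"
  shows "(\<exists>T. is_fourier_multiplier A \<Omega> \<sigma> T) \<and>
    (\<forall>T. is_fourier_multiplier A \<Omega> \<sigma> T \<longrightarrow>
      (\<forall>\<alpha>. 0 < \<alpha> \<and> \<alpha> < 1 - \<gamma> \<longrightarrow>
        (\<forall>f \<in> Lip2 A \<Omega> \<alpha>. T f \<in> Lip2 A \<Omega> (\<alpha> + \<gamma>)) \<and>
        (\<exists>M::real. \<forall>f \<in> Lip2 A \<Omega> \<alpha>.
           Lip2_norm A \<Omega> (\<alpha> + \<gamma>) (T f) \<le> ennreal M * Lip2_norm A \<Omega> \<alpha> f)))"
proof -
  interpret decaying_symbol A \<Omega> \<sigma> \<gamma> C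
    using assms by unfold_locales auto
  have "f \<in> L2_space \<Omega>" if "f \<in> Lip2 A \<Omega> \<alpha>" for f \<alpha>
    using that by (simp add: Lip2_def)
  \<comment> \<open>The operator bound is \<open>C\<close> itself, the same for every \<alpha> and
    every T.\<close>
  then show ?thesis
    using multiplier_exists multiplier_Lip2 Lip2_norm_multiplier_le by blast
qed

end
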